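(* Let $(X,\mathrm{dist})$ be a geodesic metric space. Assume that in an asymptotic cone $\mathrm{Con}_\omega(X;e,d)$ a collection $\mathcal A_\omega$ of closed subsets satisfies: $(T_1)$ every two different sets in $\mathcal A_\omega$ have at most one point in common; $(\Pi_3)$ every simple non-trivial geodesic triangle whose edges are limit geodesics is contained in a subset from $\mathcal A_\omega$. Then $\mathcal A_\omega$ satisfies $(T_2)$: every simple non-trivial geodesic triangle in $\mathrm{Con}_\omega(X;e,d)$ is contained in a subset from $\mathcal A_\omega$.
   Context: Asymptotic cones. Let $\omega$ be a non-principal ultrafilter on $\mathbb N$, $e=(e_n)$ a sequence in $X$, $d=(d_n)$ a sequence in $(0,\infty)$ with $\lim_\omega d_n=+\infty$. $\mathrm{Con}_\omega(X;e,d)$ is the quotient of the set of sequences $(x_n)$ in $X$ with $\mathrm{dist}(x_n,e_n)/d_n$ $\omega$-almost surely bounded, by the relation $\lim_\omega \mathrm{dist}(x_n,y_n)/d_n=0$, with metric $\lim_\omega \mathrm{dist}(x_n,y_n)/d_n$. The limit set of a sequence $(A_n)$ of subsets is $\lim_\omega(A_n)=\{\lim_\omega(a_n): a_n\in A_n\ \omega\text{-almost surely}\}$. A limit geodesic is a geodesic in the cone of the form $\lim_\omega(\mathfrak g_n)$ with $\mathfrak g_n$ geodesics in $X$; in general not every geodesic in a cone is a limit geodesic. *)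

theory Defs
  imports "HOL-Analysis.Analysis"
begin

section \<open>Ultrafilters on the natural numbers\<close>

definition ultrafilter :: "nat filter \<Rightarrow> bool" where
  "ultrafilter \<omega> \<longleftrightarrow>
     \<omega> \<noteq> bot \<and> (\<forall>P. eventually P \<omega> \<or> eventually (\<lambda>n. \<not> P n) \<omega>)"

definition nonprincipal_ultrafilter :: "nat filter \<Rightarrow> bool" where
  "nonprincipal_ultrafilter \<omega> \<longleftrightarrow> ultrafilter \<omega> \<and> (\<forall>n. \<omega> \<noteq> principal {n})"


section \<open>Geodesics in a metric space given by a carrier and a distance\<close>

text \<open>A geodesic is an isometric embedding of a compact interval; it is represented by the
  length \<open>l\<close> and a map that matters only on \<open>[0, l]\<close>. Constant geodesics (\<open>l = 0\<close>) are allowed.\<close>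

type_synonym 'a arc = "real \<times> (real \<Rightarrow> 'a)"

definition geodesic :: "'a set \<Rightarrow> ('a \<Rightarrow> 'a \<Rightarrow> real) \<Rightarrow> 'a arc \<Rightarrow> bool" where
  "geodesic M \<delta> \<gamma> \<longleftrightarrow>
     0 \<le> fst \<gamma> \<and> (\<forall>t\<in>{0..fst \<gamma>}. snd \<gamma> t \<in> M) \<and>
     (\<forall>s\<in>{0..fst \<gamma>}. \<forall>t\<in>{0..fst \<gamma>}. \<delta> (snd \<gamma> s) (snd \<gamma> t) = \<bar>s - t\<bar>)"

definition arc_start :: "'a arc \<Rightarrow> 'a" where
  "arc_start \<gamma> = snd \<gamma> 0"

definition arc_finish :: "'a arc \<Rightarrow> 'a" where
  "arc_finish \<gamma> = snd \<gamma> (fst \<gamma>)"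

definition arc_image :: "'a arc \<Rightarrow> 'a set" where
  "arc_image \<gamma> = snd \<gamma> ` {0..fst \<gamma>}"

definition geodesic_metric_space :: "'a set \<Rightarrow> ('a \<Rightarrow> 'a \<Rightarrow> real) \<Rightarrow> bool" where
  "geodesic_metric_space M \<delta> \<longleftrightarrow> Metric_space M \<delta> \<and>
     (\<forall>x\<in>M. \<forall>y\<in>M. \<exists>\<gamma>. geodesic M \<delta> \<gamma> \<and> arc_start \<gamma> = x \<and> arc_finish \<gamma> = y)"

definition geodesic_triangle ::
    "'a set \<Rightarrow> ('a \<Rightarrow> 'a \<Rightarrow> real) \<Rightarrow> 'a arc \<Rightarrow> 'a arc \<Rightarrow> 'a arc \<Rightarrow> bool" where
  "geodesic_triangle M \<delta> \<alpha> \<beta> \<gamma> \<longleftrightarrow>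
     geodesic M \<delta> \<alpha> \<and> geodesic M \<delta> \<beta> \<and> geodesic M \<delta> \<gamma> \<and>
     arc_finish \<alpha> = arc_start \<beta> \<and> arc_finish \<beta> = arc_start \<gamma> \<and> arc_finish \<gamma> = arc_start \<alpha>"

definition triangle_loop :: "'a arc \<Rightarrow> 'a arc \<Rightarrow> 'a arc \<Rightarrow> real \<Rightarrow> 'a" where
  "triangle_loop \<alpha> \<beta> \<gamma> t =
     (if t \<le> fst \<alpha> then snd \<alpha> t
      else if t \<le> fst \<alpha> + fst \<beta> then snd \<beta> (t - fst \<alpha>)
      else snd \<gamma> (t - fst \<alpha> - fst \<beta>))"

text \<open>Simple: the concatenation of the edges is a simple loop, i.e. injective except that its two
  end points agree. This makes sense also when some of the edges are constant.\<close>

definition simple_triangle :: "'a arc \<Rightarrow> 'a arc \<Rightarrow> 'a arc \<Rightarrow> bool" where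
  "simple_triangle \<alpha> \<beta> \<gamma> \<longleftrightarrow>
     inj_on (triangle_loop \<alpha> \<beta> \<gamma>) {0..<fst \<alpha> + fst \<beta> + fst \<gamma>}"

definition triangle_set :: "'a arc \<Rightarrow> 'a arc \<Rightarrow> 'a arc \<Rightarrow> 'a set" where
  "triangle_set \<alpha> \<beta> \<gamma> = arc_image \<alpha> \<union> arc_image \<beta> \<union> arc_image \<gamma>"

text \<open>Non-trivial: not reduced to a single point.\<close>

definition nontrivial_triangle :: "'a arc \<Rightarrow> 'a arc \<Rightarrow> 'a arc \<Rightarrow> bool" where
  "nontrivial_triangle \<alpha> \<beta> \<gamma> \<longleftrightarrow> (\<nexists>p. triangle_set \<alpha> \<beta> \<gamma> = {p})"


section \<open>Asymptotic cones\<close>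

definition cone_seqs ::
    "'a set \<Rightarrow> ('a \<Rightarrow> 'a \<Rightarrow> real) \<Rightarrow> nat filter \<Rightarrow> (nat \<Rightarrow> 'a) \<Rightarrow> (nat \<Rightarrow> real) \<Rightarrow> (nat \<Rightarrow> 'a) set" where
  "cone_seqs X \<delta> \<omega> e d =
     {x. (\<forall>n. x n \<in> X) \<and> (\<exists>C. eventually (\<lambda>n. \<delta> (x n) (e n) / d n \<le> C) \<omega>)}"

definition cone_rel ::
    "'a set \<Rightarrow> ('a \<Rightarrow> 'a \<Rightarrow> real) \<Rightarrow> nat filter \<Rightarrow> (nat \<Rightarrow> 'a) \<Rightarrow> (nat \<Rightarrow> real) \<Rightarrow> (nat \<Rightarrow> 'a) rel" where
  "cone_rel X \<delta> \<omega> e d =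
     {(x, y). x \<in> cone_seqs X \<delta> \<omega> e d \<and> y \<in> cone_seqs X \<delta> \<omega> e d \<and>
              ((\<lambda>n. \<delta> (x n) (y n) / d n) \<longlongrightarrow> 0) \<omega>}"

definition asymp_cone ::
    "'a set \<Rightarrow> ('a \<Rightarrow> 'a \<Rightarrow> real) \<Rightarrow> nat filter \<Rightarrow> (nat \<Rightarrow> 'a) \<Rightarrow> (nat \<Rightarrow> real) \<Rightarrow> (nat \<Rightarrow> 'a) set set" where
  "asymp_cone X \<delta> \<omega> e d = cone_seqs X \<delta> \<omega> e d // cone_rel X \<delta> \<omega> e d"

definition cone_point ::
    "'a set \<Rightarrow> ('a \<Rightarrow> 'a \<Rightarrow> real) \<Rightarrow> nat filter \<Rightarrow> (nat \<Rightarrow> 'a) \<Rightarrow> (nat \<Rightarrow> real) \<Rightarrow> (nat \<Rightarrow> 'a) \<Rightarrow> (nat \<Rightarrow> 'a) set" where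
  "cone_point X \<delta> \<omega> e d x = cone_rel X \<delta> \<omega> e d `` {x}"

text \<open>The value outside the cone is irrelevant; it is \<open>0\<close> because \<^locale>\<open>Metric_space\<close> asks for
  a nonnegative symmetric function on the whole type.\<close>

definition cone_dist ::
    "'a set \<Rightarrow> ('a \<Rightarrow> 'a \<Rightarrow> real) \<Rightarrow> nat filter \<Rightarrow> (nat \<Rightarrow> 'a) \<Rightarrow> (nat \<Rightarrow> real) \<Rightarrow>
      (nat \<Rightarrow> 'a) set \<Rightarrow> (nat \<Rightarrow> 'a) set \<Rightarrow> real" where
  "cone_dist X \<delta> \<omega> e d p q =
     (if p \<in> asymp_cone X \<delta> \<omega> e d \<and> q \<in> asymp_cone X \<delta> \<omega> e d
      then THE r. \<exists>x\<in>p. \<exists>y\<in>q. ((\<lambda>n. \<delta> (x n) (y n) / d n) \<longlongrightarrow> r) \<omega>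
      else 0)"

definition cone_topology ::
    "'a set \<Rightarrow> ('a \<Rightarrow> 'a \<Rightarrow> real) \<Rightarrow> nat filter \<Rightarrow> (nat \<Rightarrow> 'a) \<Rightarrow> (nat \<Rightarrow> real) \<Rightarrow>
      (nat \<Rightarrow> 'a) set topology" where
  "cone_topology X \<delta> \<omega> e d = Metric_space.mtopology (asymp_cone X \<delta> \<omega> e d) (cone_dist X \<delta> \<omega> e d)"

definition limit_set ::
    "'a set \<Rightarrow> ('a \<Rightarrow> 'a \<Rightarrow> real) \<Rightarrow> nat filter \<Rightarrow> (nat \<Rightarrow> 'a) \<Rightarrow> (nat \<Rightarrow> real) \<Rightarrow> (nat \<Rightarrow> 'a set) \<Rightarrow>
      (nat \<Rightarrow> 'a) set set" where
  "limit_set X \<delta> \<omega> e d A =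
     {cone_point X \<delta> \<omega> e d a | a.
        a \<in> cone_seqs X \<delta> \<omega> e d \<and> eventually (\<lambda>n. a n \<in> A n) \<omega>}"

definition limit_geodesic ::
    "'a set \<Rightarrow> ('a \<Rightarrow> 'a \<Rightarrow> real) \<Rightarrow> nat filter \<Rightarrow> (nat \<Rightarrow> 'a) \<Rightarrow> (nat \<Rightarrow> real) \<Rightarrow>
      (nat \<Rightarrow> 'a) set arc \<Rightarrow> bool" where
  "limit_geodesic X \<delta> \<omega> e d \<gamma> \<longleftrightarrow>
     geodesic (asymp_cone X \<delta> \<omega> e d) (cone_dist X \<delta> \<omega> e d) \<gamma> \<and>
     (\<exists>g. (\<forall>n. geodesic X \<delta> (g n)) \<and>
          arc_image \<gamma> = limit_set X \<delta> \<omega> e d (\<lambda>n. arc_image (g n)))"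


section \<open>The asymptotic cone is a metric space\<close>

lemma ultrafilter_bounded_limit:
  fixes f :: "nat \<Rightarrow> real"
  assumes u: "ultrafilter \<omega>" and b: "eventually (\<lambda>n. f n \<in> {a..b}) \<omega>"
  shows "\<exists>r. (f \<longlongrightarrow> r) \<omega>"
proof -
  have nb: "filtermap f \<omega> \<noteq> bot"
    using u by (simp add: ultrafilter_def filtermap_bot_iff)
  have "eventually (\<lambda>x. x \<in> {a..b}) (filtermap f \<omega>)"
    using b by (simp add: eventually_filtermap)
  then obtain r where r: "inf (nhds r) (filtermap f \<omega>) \<noteq> bot"
    using compact_Icc[of a b] nb unfolding compact_filter by blast
  have "eventually (\<lambda>n. f n \<in> S) \<omega>" if S: "open S" "r \<in> S" for S
  proof (rule ccontr)
    assume "\<not> ?thesis"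
    then have "eventually (\<lambda>n. f n \<notin> S) \<omega>"
      using u unfolding ultrafilter_def by blast
    then have "eventually (\<lambda>x. x \<notin> S) (filtermap f \<omega>)"
      by (simp add: eventually_filtermap)
    moreover have "eventually (\<lambda>x. x \<in> S) (nhds r)"
      using S eventually_nhds by blast
    ultimately have "eventually (\<lambda>x. False) (inf (nhds r) (filtermap f \<omega>))"
      unfolding eventually_inf by blast
    then show False using r by (simp add: trivial_limit_def)
  qed
  then show ?thesis unfolding tendsto_def by blast
qed

locale cone_data = Metric_space X \<delta> for X :: "'a set" and \<delta> +
  fixes \<omega> :: "nat filter" and e :: "nat \<Rightarrow> 'a" and d :: "nat \<Rightarrow> real"
  assumes ultra: "ultrafilter \<omega>" and base: "\<And>n. e n \<in> X" and scale: "\<And>n. 0 < d n"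
begin

abbreviation "S \<equiv> cone_seqs X \<delta> \<omega> e d"
abbreviation "R \<equiv> cone_rel X \<delta> \<omega> e d"
abbreviation "Con \<equiv> asymp_cone X \<delta> \<omega> e d"
abbreviation "D \<equiv> cone_dist X \<delta> \<omega> e d"
abbreviation "q x y \<equiv> (\<lambda>n. \<delta> (x n) (y n) / d n)"

lemma nonbot: "\<omega> \<noteq> bot"
  using ultra by (simp add: ultrafilter_def)

lemma S_X: "x \<in> S \<Longrightarrow> x n \<in> X"
  by (simp add: cone_seqs_def)

lemma q_nonneg: "0 \<le> q x y n"
  using scale[of n] by (simp add: less_imp_le)

lemma q_commute: "q x y = q y x"
  using commute by auto

lemma q_triangle:
  assumes "x \<in> S" "y \<in> S" "z \<in> S" shows "q x z n \<le> q x y n + q y z n"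
  using triangle[OF S_X[OF assms(1), of n] S_X[OF assms(2), of n] S_X[OF assms(3), of n]] scale[of n]
  by (simp add: add_divide_distrib[symmetric] divide_right_mono less_imp_le)

lemma q_limit:
  assumes x: "x \<in> S" and y: "y \<in> S" shows "\<exists>r. (q x y \<longlongrightarrow> r) \<omega>"
proof -
  obtain A B where A: "eventually (\<lambda>n. q x e n \<le> A) \<omega>" and B: "eventually (\<lambda>n. q y e n \<le> B) \<omega>"
    using x y by (auto simp: cone_seqs_def)
  have eS: "e \<in> S"
    using base by (auto simp: cone_seqs_def intro!: exI[of _ 0])
  have "eventually (\<lambda>n. q x y n \<in> {0..A + B}) \<omega>"
    using A B
  proof eventually_elim
    case (elim n)
    then show ?case
      using q_triangle[OF x eS y, of n] q_nonneg[where x = x and y = y and n = n] commute[of "e n" "y n"] by auto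
  qed
  then show ?thesis by (rule ultrafilter_bounded_limit[OF ultra])
qed

lemma equiv_R: "equiv S R"
proof (rule equivI)
  show "R \<subseteq> S \<times> S" by (auto simp: cone_rel_def)
  show "refl_on S R"
    by (rule refl_onI) (auto simp: cone_rel_def S_X)
  show "sym R"
    by (rule symI) (auto simp: cone_rel_def commute)
  show "trans R"
  proof (rule transI)
    fix x y z assume "(x, y) \<in> R" "(y, z) \<in> R"
    then have S: "x \<in> S" "y \<in> S" "z \<in> S" and l: "(q x y \<longlongrightarrow> 0) \<omega>" "(q y z \<longlongrightarrow> 0) \<omega>"
      by (auto simp: cone_rel_def)
    have "(q x z \<longlongrightarrow> 0) \<omega>"
    proof (rule tendsto_sandwich[where f = "\<lambda>n. 0" and h = "\<lambda>n. q x y n + q y z n"])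
      show "((\<lambda>n. q x y n + q y z n) \<longlongrightarrow> 0) \<omega>" using tendsto_add[OF l] by simp
      show "((\<lambda>n. 0::real) \<longlongrightarrow> 0) \<omega>" by simp
      show "eventually (\<lambda>n. 0 \<le> q x z n) \<omega>" using q_nonneg by (intro always_eventually) blast
      show "eventually (\<lambda>n. q x z n \<le> q x y n + q y z n) \<omega>"
        using q_triangle[OF S] by (intro always_eventually) blast
    qed
    then show "(x, z) \<in> R" using S by (simp add: cone_rel_def)
  qed
qed

lemma q_limit_cong:
  assumes "(x, x') \<in> R" "(y, y') \<in> R" "(q x y \<longlongrightarrow> r) \<omega>" shows "(q x' y' \<longlongrightarrow> r) \<omega>"
proof -
  have S: "x \<in> S" "x' \<in> S" "y \<in> S" "y' \<in> S"
    and l: "(q x x' \<longlongrightarrow> 0) \<omega>" "(q y y' \<longlongrightarrow> 0) \<omega>"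
    using assms(1,2) by (auto simp: cone_rel_def)
  have "((\<lambda>n. q x' y' n - q x y n) \<longlongrightarrow> 0) \<omega>"
  proof (rule tendsto_rabs_zero_cancel, rule tendsto_sandwich[where f = "\<lambda>n. 0" and h = "\<lambda>n. q x x' n + q y y' n"])
    show "((\<lambda>n. q x x' n + q y y' n) \<longlongrightarrow> 0) \<omega>" using tendsto_add[OF l] by simp
    show "((\<lambda>n. 0::real) \<longlongrightarrow> 0) \<omega>" by simp
    show "eventually (\<lambda>n. 0 \<le> \<bar>q x' y' n - q x y n\<bar>) \<omega>" by simp
    show "eventually (\<lambda>n. \<bar>q x' y' n - q x y n\<bar> \<le> q x x' n + q y y' n) \<omega>"
    proof (intro always_eventually allI)
      fix n
      show "\<bar>q x' y' n - q x y n\<bar> \<le> q x x' n + q y y' n"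
        using q_triangle[OF S(2,1,4), of n] q_triangle[OF S(1,3,4), of n]
          q_triangle[OF S(1,2,3), of n] q_triangle[OF S(2,4,3), of n]
          commute[of "x n" "x' n"] commute[of "y n" "y' n"] by simp
    qed
  qed
  from tendsto_add[OF this assms(3)] show ?thesis by simp
qed

lemma cone_dist_eq:
  assumes "p \<in> Con" "p' \<in> Con" "x \<in> p" "y \<in> p'" "(q x y \<longlongrightarrow> r) \<omega>"
  shows "D p p' = r"
proof -
  have "s = r" if "x' \<in> p" "y' \<in> p'" "(q x' y' \<longlongrightarrow> s) \<omega>" for x' y' s
  proof -
    have "(x, x') \<in> R" "(y, y') \<in> R"
      using assms(1-4) that quotient_eq_iff[OF equiv_R] unfolding asymp_cone_def by blast+
    from q_limit_cong[OF this assms(5)] show ?thesis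
      using that(3) tendsto_unique[OF nonbot] by blast
  qed
  then have "(THE r. \<exists>x\<in>p. \<exists>y\<in>p'. (q x y \<longlongrightarrow> r) \<omega>) = r"
    using assms(3-5) by (intro the_equality) blast+
  then show ?thesis using assms(1,2) by (simp add: cone_dist_def)
qed

lemma cone_rep:
  assumes "p \<in> Con" obtains x where "x \<in> p" "x \<in> S"
  using assms in_quotient_imp_non_empty[OF equiv_R] in_quotient_imp_subset[OF equiv_R]
  unfolding asymp_cone_def by blast

lemma cone_dist_lim:
  assumes "p \<in> Con" "p' \<in> Con" "x \<in> p" "y \<in> p'" shows "(q x y \<longlongrightarrow> D p p') \<omega>"
proof -
  have "x \<in> S" "y \<in> S"
    using assms in_quotient_imp_subset[OF equiv_R] unfolding asymp_cone_def by blast+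
  then obtain r where "(q x y \<longlongrightarrow> r) \<omega>" using q_limit by blast
  then show ?thesis using cone_dist_eq[OF assms] by simp
qed

lemma Metric_space_cone: "Metric_space Con D"
proof
  fix p p'
  show "0 \<le> D p p'"
  proof (cases "p \<in> Con \<and> p' \<in> Con")
    case True
    then obtain x y where "x \<in> p" "y \<in> p'" using cone_rep by metis
    then have "(q x y \<longlongrightarrow> D p p') \<omega>" using cone_dist_lim True by blast
    then show ?thesis
      using q_nonneg by (intro tendsto_lowerbound[OF _ _ nonbot] always_eventually) blast+
  qed (auto simp: cone_dist_def)
  show "D p p' = D p' p"
  proof (cases "p \<in> Con \<and> p' \<in> Con")
    case True
    then obtain x y where xy: "x \<in> p" "y \<in> p'" using cone_rep by metis
    then have "(q y x \<longlongrightarrow> D p' p) \<omega>" using cone_dist_lim True by blast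
    then have "(q x y \<longlongrightarrow> D p' p) \<omega>" using q_commute[of x y] by simp
    then show ?thesis using cone_dist_eq True xy by blast
  qed (auto simp: cone_dist_def)
next
  fix p p' assume C: "p \<in> Con" "p' \<in> Con"
  obtain x where x: "x \<in> p" "x \<in> S" using cone_rep[OF C(1)] by blast
  obtain y where y: "y \<in> p'" "y \<in> S" using cone_rep[OF C(2)] by blast
  have l: "(q x y \<longlongrightarrow> D p p') \<omega>" using cone_dist_lim C x y by blast
  have "D p p' = 0 \<longleftrightarrow> (q x y \<longlongrightarrow> 0) \<omega>"
    using l tendsto_unique[OF nonbot l] by metis
  also have "\<dots> \<longleftrightarrow> (x, y) \<in> R"
    using x(2) y(2) by (simp add: cone_rel_def)
  also have "\<dots> \<longleftrightarrow> p = p'"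
    using quotient_eq_iff[OF equiv_R C[unfolded asymp_cone_def] x(1) y(1)] by simp
  finally show "D p p' = 0 \<longleftrightarrow> p = p'" .
next
  fix p1 p2 p3 assume C: "p1 \<in> Con" "p2 \<in> Con" "p3 \<in> Con"
  obtain x where x: "x \<in> p1" "x \<in> S" using cone_rep[OF C(1)] by blast
  obtain y where y: "y \<in> p2" "y \<in> S" using cone_rep[OF C(2)] by blast
  obtain z where z: "z \<in> p3" "z \<in> S" using cone_rep[OF C(3)] by blast
  have l: "(q x z \<longlongrightarrow> D p1 p3) \<omega>" "((\<lambda>n. q x y n + q y z n) \<longlongrightarrow> D p1 p2 + D p2 p3) \<omega>"
    using cone_dist_lim[OF C(1,3) x(1) z(1)]
      tendsto_add[OF cone_dist_lim[OF C(1,2) x(1) y(1)] cone_dist_lim[OF C(2,3) y(1) z(1)]] .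
  have "eventually (\<lambda>n. q x z n \<le> q x y n + q y z n) \<omega>"
    using q_triangle[OF x(2) y(2) z(2)] by (intro always_eventually allI)
  from tendsto_le[OF nonbot l(2,1) this] show "D p1 p3 \<le> D p1 p2 + D p2 p3" .
qed

end

end

theory Submission
  imports Defs
begin

text \<open>Any two points of the cone are joined by a limit geodesic, and a subsegment of a limit geodesic
  is one. If \<open>f\<close>, \<open>g\<close>, \<open>h\<close> are geodesics with the same end points, \<open>g\<close> and \<open>h\<close> are disjoint
  inside, and all simple bigons formed by \<open>f\<close> with \<open>g\<close> and with \<open>h\<close> lie in pieces, then \<open>f\<close> is
  covered by open arcs that lie in pieces; overlapping arcs lie in the same piece by \<open>(T1)\<close>, so by
  connectedness a single piece contains \<open>f\<close>, hence \<open>g\<close> and \<open>h\<close>. With \<open>f\<close> a geodesic consisting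
  of fewer limit geodesics this gives, by induction from \<open>(\<Pi>3)\<close>, that simple bigons with one
  limit edge and one piecewise limit edge lie in pieces. Connecting consecutive points of a fine
  partition of an arbitrary geodesic by limit geodesics yields again a geodesic, so approximation (pieces are
  closed) and one more application settle all simple bigons. In a simple triangle the edges are then
  exchanged for limit geodesics one at a time: the new edge is cut by the two other edges into
  bigons and smaller triangles with one more limit edge.\<close>

section \<open>Isometric paths in metric spaces\<close>

text \<open>\<open>s\<close> is the last point of \<open>S\<close> before \<open>u\<close> and
  \<open>t\<close> the first one after it; compactness makes both exist. Applied to the parameters
  where two paths meet, this cuts out the bigon or triangle around a given parameter.\<close>

lemma closed_gap:
  fixes u :: real
  assumes "closed S" "p \<in> S" "q \<in> S" "p \<le> u" "u \<le> q" "u \<notin> S"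
  obtains s t where "s \<in> S" "t \<in> S" "p \<le> s" "s < u" "u < t" "t \<le> q" "\<And>v. s < v \<Longrightarrow> v < t \<Longrightarrow> v \<notin> S"
proof -
  have "compact (S \<inter> {p..u})" "S \<inter> {p..u} \<noteq> {}"
    using assms by (auto intro: closed_Int_compact)
  then obtain s where s: "s \<in> S \<inter> {p..u}" "\<And>v. v \<in> S \<inter> {p..u} \<Longrightarrow> v \<le> s"
    using compact_attains_sup by metis
  have "compact (S \<inter> {u..q})" "S \<inter> {u..q} \<noteq> {}"
    using assms by (auto intro: closed_Int_compact)
  then obtain t where t: "t \<in> S \<inter> {u..q}" "\<And>v. v \<in> S \<inter> {u..q} \<Longrightarrow> t \<le> v"
    using compact_attains_inf by metis
  have "s \<noteq> u" "t \<noteq> u" using s t assms by auto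
  moreover have "v \<notin> S" if "s < v" "v < t" for v
  proof
    assume "v \<in> S"
    then show False using s t that by (cases "v \<le> u") fastforce+
  qed
  ultimately show thesis using s t by (intro that[of s t]) auto
qed

lemma image_Int_singleton:
  assumes "u \<in> S" "v \<in> T" "f u = p" "g v = p"
    and "\<And>s t. s \<in> S \<Longrightarrow> t \<in> T \<Longrightarrow> f s = g t \<Longrightarrow> f s = p"
  shows "f ` S \<inter> g ` T = {p}"
proof (intro equalityI subsetI)
  fix q assume "q \<in> f ` S \<inter> g ` T"
  then obtain s t where "s \<in> S" "t \<in> T" "q = f s" "q = g t" by auto
  then show "q \<in> {p}" using assms(5)[of s t] by simp
next
  fix q assume "q \<in> {p}"
  then show "q \<in> f ` S \<inter> g ` T" using assms(1-4) imageI[of u S f] imageI[of v T g] by simp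
qed

context Metric_space
begin

text \<open>The domain is an arbitrary interval, so that subsegments keep their parameters and
  geodesics with a common end point can be compared at equal times.\<close>

definition isom :: "(real \<Rightarrow> 'a) \<Rightarrow> real \<Rightarrow> real \<Rightarrow> bool" where
  "isom f a b \<longleftrightarrow> (\<forall>t\<in>{a..b}. f t \<in> M) \<and> (\<forall>s\<in>{a..b}. \<forall>t\<in>{a..b}. d (f s) (f t) = \<bar>s - t\<bar>)"

lemma isom_in: "isom f a b \<Longrightarrow> a \<le> t \<Longrightarrow> t \<le> b \<Longrightarrow> f t \<in> M"
  by (simp add: isom_def)

lemma isom_dist:
  "isom f a b \<Longrightarrow> a \<le> s \<Longrightarrow> s \<le> b \<Longrightarrow> a \<le> t \<Longrightarrow> t \<le> b \<Longrightarrow> d (f s) (f t) = \<bar>s - t\<bar>"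
  by (simp add: isom_def)

lemma isom_sub: "isom f a b \<Longrightarrow> a \<le> s \<Longrightarrow> t \<le> b \<Longrightarrow> isom f s t"
  by (auto simp: isom_def)

lemma isom_cong: "(\<And>t. a \<le> t \<Longrightarrow> t \<le> b \<Longrightarrow> f t = g t) \<Longrightarrow> isom f a b \<longleftrightarrow> isom g a b"
  by (auto simp: isom_def)

lemma isom_inj: "isom f a b \<Longrightarrow> f s = f t \<Longrightarrow> a \<le> s \<Longrightarrow> s \<le> b \<Longrightarrow> a \<le> t \<Longrightarrow> t \<le> b \<Longrightarrow> s = t"
  using isom_dist[of f a b s t] isom_in[of f a b t] mdist_zero[of "f t"] by auto

lemma isom_shift: "isom f a b \<Longrightarrow> isom (\<lambda>t. f (t - c)) (a + c) (b + c)"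
  by (auto simp: isom_def)

lemma isom_rev: "isom f a b \<Longrightarrow> isom (\<lambda>t. f (c - t)) (c - b) (c - a)"
  by (auto simp: isom_def)

text \<open>Both \<open>u - a\<close> and \<open>v - a\<close> are the distance from the common
  starting point to the common value.\<close>

lemma isom_eq_left:
  assumes "isom f a b" "isom g a c" "f a = g a" "f u = g v" "a \<le> u" "u \<le> b" "a \<le> v" "v \<le> c"
  shows "u = v"
  using isom_dist[OF assms(1), of a u] isom_dist[OF assms(2), of a v] assms by auto

lemma isom_eq_right:
  assumes "isom f a c" "isom g b c" "f c = g c" "f u = g v" "a \<le> u" "u \<le> c" "b \<le> v" "v \<le> c"
  shows "u = v"
  using isom_dist[OF assms(1), of u c] isom_dist[OF assms(2), of v c] assms by auto

text \<open>The route through the junction bounds \<open>d (f s) (g t)\<close> by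
  \<open>t - s\<close> from above. A smaller value would give a path from \<open>f a\<close> via
  \<open>f s\<close> and \<open>g t\<close> to \<open>g b\<close> shorter than
  \<open>b - a\<close>.\<close>

lemma isom_concat:
  assumes f: "isom f a c" and g: "isom g c b" and c: "f c = g c" "a \<le> c" "c \<le> b"
    and e: "d (f a) (g b) = b - a"
  shows "isom (\<lambda>t. if t \<le> c then f t else g t) a b"
proof -
  have *: "d (f s) (g t) = t - s" if st: "a \<le> s" "s \<le> c" "c \<le> t" "t \<le> b" for s t
  proof -
    have M: "f a \<in> M" "f s \<in> M" "f c \<in> M" "g t \<in> M" "g b \<in> M"
      using f g st c isom_in by auto
    have "d (f s) (f c) = c - s" "d (f a) (f s) = s - a" "d (g c) (g t) = t - c" "d (g t) (g b) = b - t"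
      using isom_dist[OF f, of s c] isom_dist[OF f, of a s] isom_dist[OF g, of c t]
        isom_dist[OF g, of t b] st c by auto
    then show ?thesis
      using triangle[OF M(2,3,4)] triangle[OF M(1,2,5)] triangle[OF M(2,4,5)] e c by simp
  qed
  show ?thesis
    unfolding isom_def
    using isom_in[OF f] isom_in[OF g] isom_dist[OF f] isom_dist[OF g] * c
    by (auto simp: commute[of "g _" "f _"])
qed

lemma isom_dist_continuous:
  assumes "isom f a b" "isom g a b"
  shows "continuous_on {a..b} (\<lambda>t. d (f t) (g t))"
proof -
  have "d (f s) (g s) \<le> d (f t) (g t) + 2 * \<bar>s - t\<bar>" if st: "s \<in> {a..b}" "t \<in> {a..b}" for s t
  proof -
    have M: "f s \<in> M" "f t \<in> M" "g s \<in> M" "g t \<in> M"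
      using assms isom_in st by auto
    have "d (f s) (f t) = \<bar>s - t\<bar>" "d (g t) (g s) = \<bar>s - t\<bar>"
      using isom_dist[OF assms(1), of s t] isom_dist[OF assms(2), of t s] st by auto
    then show ?thesis
      using triangle[OF M(1,2,3)] triangle[OF M(2,4,3)] by simp
  qed
  then have "\<bar>d (f s) (g s) - d (f t) (g t)\<bar> \<le> 2 * \<bar>s - t\<bar>" if "s \<in> {a..b}" "t \<in> {a..b}" for s t
    using that abs_minus_commute[of s t] by (smt (verit))
  then have "2-lipschitz_on {a..b} (\<lambda>t. d (f t) (g t))"
    by (intro lipschitz_onI) (auto simp: dist_real_def)
  then show ?thesis by (rule lipschitz_on_continuous_on)
qed

lemma isom_agree_closed:
  assumes "isom f a b" "isom g a b"
  shows "closed {t\<in>{a..b}. f t = g t}"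
proof -
  have "{t\<in>{a..b}. f t = g t} = {t\<in>{a..b}. d (f t) (g t) = 0}"
    using assms isom_in by auto
  then show ?thesis
    using continuous_closed_preimage_constant[OF isom_dist_continuous[OF assms], of 0] by simp
qed

lemma isom_gap:
  assumes "isom f a b" "isom g a b" "f a = g a" "f b = g b" "f u \<noteq> g u" "a \<le> u" "u \<le> b"
  obtains s t where "a \<le> s" "s < u" "u < t" "t \<le> b" "f s = g s" "f t = g t"
    "\<And>v. s < v \<Longrightarrow> v < t \<Longrightarrow> f v \<noteq> g v"
proof -
  let ?S = "{t\<in>{a..b}. f t = g t}"
  obtain s t where *: "s \<in> ?S" "t \<in> ?S" "a \<le> s" "s < u" "u < t" "t \<le> b" "\<And>v. s < v \<Longrightarrow> v < t \<Longrightarrow> v \<notin> ?S"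
    using closed_gap[OF isom_agree_closed[OF assms(1,2)], of a b u] assms by auto
  show thesis using * by (intro that[of s t]) fastforce+
qed

text \<open>Only the end points and the image are kept, because being a limit geodesic is, for a
  geodesic, a condition on its image.\<close>

definition seg :: "'a \<Rightarrow> 'a \<Rightarrow> 'a set \<Rightarrow> bool" where
  "seg x y K \<longleftrightarrow> (\<exists>f l. 0 \<le> l \<and> isom f 0 l \<and> f 0 = x \<and> f l = y \<and> K = f ` {0..l})"

text \<open>The start \<open>a\<close> is free, so several segments can be parametrised in a way
  that aligns them at a common vertex.\<close>

lemma seg_param:
  assumes "seg x y K" "b - a = d x y"
  obtains f where "isom f a b" "f a = x" "f b = y" "f ` {a..b} = K"
proof -
  obtain f l where f: "0 \<le> l" "isom f 0 l" "f 0 = x" "f l = y" "K = f ` {0..l}"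
    using assms unfolding seg_def by blast
  have l: "l = b - a" using isom_dist[OF f(2), of 0 l] f assms by auto
  have "(\<lambda>t. f (t - a)) ` {a..b} = K"
  proof -
    have "(\<lambda>t. t - a) ` {a..b} = {0..b - a}" by (auto intro!: image_eqI[of _ _ "_ + a"])
    then show ?thesis using f l image_comp[of f "\<lambda>t. t - a" "{a..b}"] by (simp add: comp_def)
  qed
  then show thesis
    using isom_shift[OF f(2), of a] f l by (intro that[of "\<lambda>t. f (t - a)"]) auto
qed

lemma seg_image:
  assumes "isom f a b" "a \<le> b" shows "seg (f a) (f b) (f ` {a..b})"
proof -
  have "(\<lambda>t. t + a) ` {0..b - a} = {a..b}" by (auto intro!: image_eqI[of _ _ "_ - a"])
  then have "f ` {a..b} = (\<lambda>t. f (t + a)) ` {0..b - a}"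
    using image_comp[of f "\<lambda>t. t + a" "{0..b - a}"] by (simp add: comp_def)
  moreover have "isom (\<lambda>t. f (t + a)) 0 (b - a)" using isom_shift[OF assms(1), of "- a"] by simp
  ultimately show ?thesis
    unfolding seg_def using assms by (intro exI[of _ "\<lambda>t. f (t + a)"] exI[of _ "b - a"]) auto
qed

lemma seg_sym:
  assumes "seg x y K" shows "seg y x K"
proof -
  obtain f l where f: "0 \<le> l" "isom f 0 l" "f 0 = x" "f l = y" "K = f ` {0..l}"
    using assms unfolding seg_def by blast
  have "(\<lambda>t. l - t) ` {0..l} = {0..l}" by (auto intro!: image_eqI[of _ _ "l - _"])
  then have "f ` {0..l} = (\<lambda>t. f (l - t)) ` {0..l}"
    using image_comp[of f "\<lambda>t. l - t" "{0..l}"] by (simp add: comp_def)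
  then show ?thesis
    unfolding seg_def using isom_rev[OF f(2), of l] f
    by (intro exI[of _ "\<lambda>t. f (l - t)"] exI[of _ l]) auto
qed

lemma seg_ends: "seg x y K \<Longrightarrow> x \<in> K \<and> y \<in> K \<and> x \<in> M \<and> y \<in> M"
  unfolding seg_def using isom_in by fastforce

lemma seg_trivial: "seg x x K \<Longrightarrow> K = {x}"
proof -
  assume "seg x x K"
  then obtain f l where f: "0 \<le> l" "isom f 0 l" "f 0 = x" "f l = x" "K = f ` {0..l}"
    unfolding seg_def by blast
  have "l = 0" using isom_inj[OF f(2), of l 0] f by auto
  then show ?thesis using f by simp
qed

text \<open>The simple triangles with three distinct vertices. Simple triangles with a constant edge
  are bigons and are treated separately.\<close>

definition tri :: "'a \<Rightarrow> 'a \<Rightarrow> 'a \<Rightarrow> 'a set \<Rightarrow> 'a set \<Rightarrow> 'a set \<Rightarrow> bool" where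
  "tri x y z F G H \<longleftrightarrow> seg x y F \<and> seg y z G \<and> seg z x H \<and> x \<noteq> y \<and> y \<noteq> z \<and> z \<noteq> x \<and>
     F \<inter> G = {y} \<and> G \<inter> H = {z} \<and> H \<inter> F = {x}"

lemma tri_rotate: "tri x y z F G H \<Longrightarrow> tri y z x G H F"
  by (auto simp: tri_def)

text \<open>Bridge to the parametrised triangles in which \<open>(\<Pi>3)\<close> is formulated:
  edges that meet only in the vertices give a loop that is injective up to its closing
  point.\<close>

lemma tri_arcs:
  assumes "tri x y z F G H"
  obtains \<alpha> \<beta> \<gamma> where "geodesic_triangle M d \<alpha> \<beta> \<gamma>" "simple_triangle \<alpha> \<beta> \<gamma>"
    "nontrivial_triangle \<alpha> \<beta> \<gamma>" "arc_image \<alpha> = F" "arc_image \<beta> = G" "arc_image \<gamma> = H"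
proof -
  have int: "F \<inter> G = {y}" "G \<inter> H = {z}" "H \<inter> F = {x}" and ne: "x \<noteq> y"
    using assms by (auto simp: tri_def)
  obtain f a where f: "0 \<le> a" "isom f 0 a" "f 0 = x" "f a = y" "F = f ` {0..a}"
    using assms by (auto simp: tri_def seg_def)
  obtain g b where g: "0 \<le> b" "isom g 0 b" "g 0 = y" "g b = z" "G = g ` {0..b}"
    using assms by (auto simp: tri_def seg_def)
  obtain h c where h: "0 \<le> c" "isom h 0 c" "h 0 = z" "h c = x" "H = h ` {0..c}"
    using assms by (auto simp: tri_def seg_def)
  have fg: "t = 0" if "f s = g t" "0 \<le> s" "s \<le> a" "0 \<le> t" "t \<le> b" for s t
  proof -
    have "g t \<in> F" "g t \<in> G" unfolding f(5) g(5) using that by (auto intro: rev_image_eqI)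
    then have "g t = g 0" using int g by auto
    then show ?thesis using isom_inj[OF g(2), of t 0] that by auto
  qed
  have gh: "t = 0" if "g s = h t" "0 \<le> s" "s \<le> b" "0 \<le> t" "t \<le> c" for s t
  proof -
    have "h t \<in> G" "h t \<in> H" unfolding g(5) h(5) using that by (auto intro: rev_image_eqI)
    then have "h t = h 0" using int h by auto
    then show ?thesis using isom_inj[OF h(2), of t 0] that by auto
  qed
  \<comment> \<open>Unlike the other two junctions, this one is at the end parameter
    \<open>c\<close> of \<open>h\<close>: it is the closing point of the loop, which the half-open
    interval omits.\<close>
  have fh: "t = c" if "f s = h t" "0 \<le> s" "s \<le> a" "0 \<le> t" "t \<le> c" for s t
  proof -
    have "h t \<in> F" "h t \<in> H" unfolding f(5) h(5) using that by (auto intro: rev_image_eqI)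
    then have "h t = h c" using int h by auto
    then show ?thesis using isom_inj[OF h(2), of t c] that by auto
  qed
  define p where "p = triangle_loop (a, f) (b, g) (c, h)"
  have p: "p t = (if t \<le> a then f t else if t \<le> a + b then g (t - a) else h (t - a - b))" for t
    by (simp add: p_def triangle_loop_def)
  have "u = v" if "p u = p v" "0 \<le> u" "u \<le> v" "v < a + b + c" for u v
  proof -
    show ?thesis
    proof (cases "u \<le> a")
      case ua: True
      consider "v \<le> a" | "a < v" "v \<le> a + b" | "a < v" "a + b < v" by linarith
      then show ?thesis
      proof cases
        case 1
        then show ?thesis using isom_inj[OF f(2), of u v] that by (simp add: p)
      next
        case 2
        then show ?thesis using fg[of u "v - a"] that ua by (simp add: p)
      next
        case 3
        then show ?thesis using fh[of u "v - a - b"] that ua by (simp add: p)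
      qed
    next
      case ua: False
      consider "v \<le> a + b" | "u \<le> a + b" "a + b < v" | "a + b < u" by linarith
      then show ?thesis
      proof cases
        case 1
        then show ?thesis using isom_inj[OF g(2), of "u - a" "v - a"] that ua by (simp add: p)
      next
        case 2
        then show ?thesis using gh[of "u - a" "v - a - b"] that ua g(1) by (simp add: p)
      next
        case 3
        then show ?thesis using isom_inj[OF h(2), of "u - a - b" "v - a - b"] that ua g(1) by (simp add: p)
      qed
    qed
  qed
  then have "inj_on p {0..<a + b + c}" by (intro linorder_inj_onI) force+
  then have "simple_triangle (a, f) (b, g) (c, h)" by (simp add: simple_triangle_def p_def)
  moreover have "geodesic_triangle M d (a, f) (b, g) (c, h)"
    using f g h by (simp add: geodesic_triangle_def geodesic_def isom_def arc_start_def arc_finish_def)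
  moreover have im: "arc_image (a, f) = F" "arc_image (b, g) = G" "arc_image (c, h) = H"
    using f g h by (simp_all add: arc_image_def)
  moreover have "nontrivial_triangle (a, f) (b, g) (c, h)"
  proof -
    have "x \<in> F" "y \<in> F" using int by auto
    then show ?thesis using ne unfolding nontrivial_triangle_def triangle_set_def im by (metis UnI1 singletonD)
  qed
  ultimately show thesis using that by blast
qed

end

section \<open>Bigons\<close>

text \<open>Isolates what the argument uses about limit geodesics: existence between any two points,
  stability under subsegments, and \<open>(\<Pi>3)\<close>. Sequences and ultrafilters do not occur
  until the locale is interpreted in the cone.\<close>

locale limit_pieces = Metric_space M d for M :: "'a set" and d +
  fixes isL :: "'a set \<Rightarrow> bool" and \<A> :: "'a set set"
  assumes L_ex: "\<And>x y. x \<in> M \<Longrightarrow> y \<in> M \<Longrightarrow> \<exists>K. seg x y K \<and> isL K"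
    and L_sub: "\<And>f a b s t. isom f a b \<Longrightarrow> isL (f ` {a..b}) \<Longrightarrow> a \<le> s \<Longrightarrow> s \<le> t \<Longrightarrow> t \<le> b \<Longrightarrow>
      isL (f ` {s..t})"
    and piece_closed: "\<And>A. A \<in> \<A> \<Longrightarrow> closedin mtopology A"
    and T1: "\<And>A B. A \<in> \<A> \<Longrightarrow> B \<in> \<A> \<Longrightarrow> A \<noteq> B \<Longrightarrow> \<exists>p. A \<inter> B \<subseteq> {p}"
    and Pi3: "\<And>x y z F G H. tri x y z F G H \<Longrightarrow> isL F \<Longrightarrow> isL G \<Longrightarrow> isL H \<Longrightarrow> \<exists>A\<in>\<A>. F \<union> G \<union> H \<subseteq> A"
begin

section \<open>Coincidence of pieces and covering of a path by pieces\<close>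

lemma piece_eq: "A \<in> \<A> \<Longrightarrow> B \<in> \<A> \<Longrightarrow> p \<in> A \<Longrightarrow> p \<in> B \<Longrightarrow> q \<in> A \<Longrightarrow> q \<in> B \<Longrightarrow> p \<noteq> q \<Longrightarrow> A = B"
  using T1 by blast

text \<open>An open arc of a geodesic has two distinct points, which is all that \<open>T1\<close>
  needs.\<close>

lemma piece_eq_isom:
  assumes "A \<in> \<A>" "B \<in> \<A>" "isom f s t" "s < t" "\<And>v. s < v \<Longrightarrow> v < t \<Longrightarrow> f v \<in> A" "\<And>v. s < v \<Longrightarrow> v < t \<Longrightarrow> f v \<in> B"
  shows "A = B"
proof -
  obtain v where v: "s < v" "v < t" using dense assms by blast
  obtain w where w: "s < w" "w < v" using dense v by blast
  have "f v \<noteq> f w" using isom_inj[OF assms(3), of v w] v w by auto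
  then show ?thesis using piece_eq[OF assms(1,2), of "f v" "f w"] assms v w by auto
qed

lemma piece_limit:
  assumes "A \<in> \<A>" "p \<in> M" "\<And>\<epsilon>. 0 < \<epsilon> \<Longrightarrow> \<exists>w\<in>A. d p w < \<epsilon>"
  shows "p \<in> A"
proof (rule ccontr)
  assume "p \<notin> A"
  then obtain r where "0 < r" "disjnt A (mball p r)"
    using piece_closed[OF assms(1)] assms(2) unfolding closedin_metric by blast
  moreover obtain w where "w \<in> A" "d p w < r" using assms(3) \<open>0 < r\<close> by blast
  moreover have "A \<subseteq> M" using piece_closed[OF assms(1)] closedin_metric by blast
  ultimately show False using assms(2) unfolding disjnt_def mball_def by auto
qed

text \<open>The piece chosen at a parameter is locally constant, hence constant on the connected
  open interval; closedness of the piece then adds the two end points.\<close>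

lemma one_piece:
  assumes f: "isom f a b" and ab: "a < b"
    and loc: "\<And>u. a < u \<Longrightarrow> u < b \<Longrightarrow>
      \<exists>s t. \<exists>A\<in>\<A>. a \<le> s \<and> s < u \<and> u < t \<and> t \<le> b \<and> (\<forall>v. s < v \<and> v < t \<longrightarrow> f v \<in> A)"
  obtains A where "A \<in> \<A>" "f ` {a..b} \<subseteq> A"
proof -
  obtain S T P where P: "\<And>u. a < u \<Longrightarrow> u < b \<Longrightarrow> P u \<in> \<A> \<and> a \<le> S u \<and> S u < u \<and> u < T u \<and> T u \<le> b \<and>
      (\<forall>v. S u < v \<and> v < T u \<longrightarrow> f v \<in> P u)"
    using loc by metis
  have eq: "P v = P u" if "a < u" "u < b" "S u < v" "v < T u" for u v
  proof -
    have u: "P u \<in> \<A>" "a \<le> S u" "T u \<le> b" "\<And>w. S u < w \<Longrightarrow> w < T u \<Longrightarrow> f w \<in> P u"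
      using P[OF that(1,2)] by auto
    have av: "a < v" "v < b" using u that by auto
    have v: "P v \<in> \<A>" "S v < v" "v < T v" "\<And>w. S v < w \<Longrightarrow> w < T v \<Longrightarrow> f w \<in> P v"
      using P[OF av] by auto
    show ?thesis
    \<comment> \<open>The parameters between \<open>max (S u) (S v)\<close> and \<open>v\<close> lie
      in both neighbourhoods, so the two pieces share an arc of \<open>f\<close>.\<close>
    proof (rule piece_eq_isom[OF v(1) u(1), of f "max (S u) (S v)" v])
      show "isom f (max (S u) (S v)) v" using isom_sub[OF f] u av by auto
    qed (use u v that in auto)
  qed
  have "P constant_on {a<..<b}"
  proof (rule locally_constant_imp_constant[OF connected_Ioo])
    fix u assume u: "u \<in> {a<..<b}"
    have "openin (top_of_set {a<..<b}) {S u<..<T u}"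
      using P[of u] u by (intro open_subset) auto
    then show "\<exists>T. openin (top_of_set {a<..<b}) T \<and> u \<in> T \<and> (\<forall>x\<in>T. P x = P u)"
    proof (intro exI conjI ballI)
      show "u \<in> {S u<..<T u}" using P[of u] u by auto
      show "P x = P u" if "x \<in> {S u<..<T u}" for x using eq[of u x] u that by auto
    qed
  qed
  then obtain A where A: "\<And>u. a < u \<Longrightarrow> u < b \<Longrightarrow> P u = A"
    unfolding constant_on_def by auto
  have in_A: "f u \<in> A" if "a < u" "u < b" for u using A[OF that] P[OF that] by blast
  have A_in: "A \<in> \<A>" using A P dense[OF ab] by metis
  have "f u \<in> A" if u: "a \<le> u" "u \<le> b" for u
  proof (rule piece_limit[OF A_in])
    show "f u \<in> M" using isom_in[OF f] u by auto
    fix \<epsilon> :: real assume "0 < \<epsilon>"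
    obtain w where w: "a < w" "w < b" "\<bar>u - w\<bar> < \<epsilon>"
    proof (cases "u = b")
      case True
      obtain w where "max a (b - \<epsilon>) < w" "w < b" using dense[of "max a (b - \<epsilon>)" b] ab \<open>0 < \<epsilon>\<close> by auto
      then show thesis using True by (intro that[of w]) auto
    next
      case False
      obtain w where "u < w" "w < min b (u + \<epsilon>)" using dense[of u "min b (u + \<epsilon>)"] u False \<open>0 < \<epsilon>\<close> by auto
      then show thesis using u by (intro that[of w]) auto
    qed
    then show "\<exists>w\<in>A. d (f u) w < \<epsilon>"
      using in_A[of w] isom_dist[OF f, of u w] u by (intro bexI[of _ "f w"]) auto
  qed
  then show thesis using A_in by (intro that[of A]) auto
qed

text \<open>The simple bigons cut out by \<open>f\<close> and \<open>g\<close> on \<open>[a, b]\<close> lie in pieces. For geodesics with a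
  common end point all intersections occur at equal parameters.\<close>

definition good :: "(real \<Rightarrow> 'a) \<Rightarrow> (real \<Rightarrow> 'a) \<Rightarrow> real \<Rightarrow> real \<Rightarrow> bool" where
  "good f g a b \<longleftrightarrow> (\<forall>s t. a \<le> s \<and> s < t \<and> t \<le> b \<and> f s = g s \<and> f t = g t \<and>
     (\<forall>v. s < v \<and> v < t \<longrightarrow> f v \<noteq> g v) \<longrightarrow> (\<exists>A\<in>\<A>. f ` {s..t} \<union> g ` {s..t} \<subseteq> A))"

lemma goodD:
  "good f g a b \<Longrightarrow> a \<le> s \<Longrightarrow> s < t \<Longrightarrow> t \<le> b \<Longrightarrow> f s = g s \<Longrightarrow> f t = g t \<Longrightarrow>
    (\<And>v. s < v \<Longrightarrow> v < t \<Longrightarrow> f v \<noteq> g v) \<Longrightarrow> \<exists>A\<in>\<A>. f ` {s..t} \<union> g ` {s..t} \<subseteq> A"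
  unfolding good_def by blast

lemma good_sym: "good f g a b \<Longrightarrow> good g f a b"
  unfolding good_def by (metis sup_commute)

lemma good_gap:
  assumes "isom f a b" "isom g a b" "f a = g a" "f b = g b" "good f g a b" "f u \<noteq> g u" "a \<le> u" "u \<le> b"
  obtains s t A where "A \<in> \<A>" "a \<le> s" "s < u" "u < t" "t \<le> b" "f ` {s..t} \<union> g ` {s..t} \<subseteq> A"
proof -
  obtain s t where "a \<le> s" "s < u" "u < t" "t \<le> b" "f s = g s" "f t = g t"
    "\<And>v. s < v \<Longrightarrow> v < t \<Longrightarrow> f v \<noteq> g v"
    using isom_gap[OF assms(1-4) assms(6-8)] by blast
  moreover from this obtain A where "A \<in> \<A>" "f ` {s..t} \<union> g ` {s..t} \<subseteq> A"
    using assms(5) unfolding good_def by (meson order_less_trans)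
  ultimately show thesis using that by blast
qed

text \<open>Wherever \<open>g\<close> leaves \<open>f\<close>, the bigon around that parameter lies
  in a piece that shares an arc of \<open>f\<close> with \<open>A\<close>, and is therefore
  \<open>A\<close>.\<close>

lemma good_transfer:
  assumes "isom f a b" "isom g a b" "f a = g a" "f b = g b" "good f g a b"
    and A: "A \<in> \<A>" "f ` {a..b} \<subseteq> A"
  shows "g ` {a..b} \<subseteq> A"
proof
  fix p assume "p \<in> g ` {a..b}"
  then obtain u where u: "p = g u" "a \<le> u" "u \<le> b" by auto
  show "p \<in> A"
  proof (cases "f u = g u")
    case True
    then show ?thesis using A u by (metis atLeastAtMost_iff image_subset_iff)
  next
    case False
    obtain s t B where B: "B \<in> \<A>" "a \<le> s" "s < u" "u < t" "t \<le> b" "f ` {s..t} \<union> g ` {s..t} \<subseteq> B"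
      using good_gap[OF assms(1-5) False u(2,3)] .
    have "A = B"
    proof (rule piece_eq_isom[OF A(1) B(1), of f s t])
      show "isom f s t" using isom_sub[OF assms(1)] B by auto
    qed (use A B in auto)
    then show ?thesis using B u by auto
  qed
qed

text \<open>Since \<open>g\<close> and \<open>h\<close> do not meet inside, at every interior
  parameter \<open>f\<close> differs from one of them, so some bigon puts an arc of \<open>f\<close>
  around it into a piece. \<open>one_piece\<close> merges these pieces and
  \<open>good_transfer\<close> carries the result back to \<open>g\<close> and
  \<open>h\<close>.\<close>

lemma sandwich:
  assumes f: "isom f a b" and g: "isom g a b" and h: "isom h a b" and ab: "a < b"
    and e: "f a = g a" "f b = g b" "f a = h a" "f b = h b"
    and gd: "good f g a b" "good f h a b"
    and disj: "\<And>v. a < v \<Longrightarrow> v < b \<Longrightarrow> g v \<noteq> h v"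
  shows "\<exists>A\<in>\<A>. g ` {a..b} \<union> h ` {a..b} \<subseteq> A"
proof -
  obtain A where A: "A \<in> \<A>" "f ` {a..b} \<subseteq> A"
  proof (rule one_piece[OF f ab])
    fix u assume u: "a < u" "u < b"
    then have "f u \<noteq> g u \<or> f u \<noteq> h u" using disj by metis
    then obtain s t A where "A \<in> \<A>" "a \<le> s" "s < u" "u < t" "t \<le> b" "f ` {s..t} \<subseteq> A"
      using good_gap[OF f g e(1,2) gd(1), of u] good_gap[OF f h e(3,4) gd(2), of u] u
      by (metis le_sup_iff less_imp_le)
    then show "\<exists>s t. \<exists>A\<in>\<A>. a \<le> s \<and> s < u \<and> u < t \<and> t \<le> b \<and> (\<forall>v. s < v \<and> v < t \<longrightarrow> f v \<in> A)"
      by (intro exI[of _ s] exI[of _ t] bexI[of _ A]) auto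
  qed
  have "g ` {a..b} \<subseteq> A" "h ` {a..b} \<subseteq> A"
    by (rule good_transfer[OF f g e(1,2) gd(1) A], rule good_transfer[OF f h e(3,4) gd(2) A])
  then show ?thesis using A(1) by blast
qed

section \<open>Bigons with one limit edge and one piecewise limit edge\<close>

definition L :: "(real \<Rightarrow> 'a) \<Rightarrow> real \<Rightarrow> real \<Rightarrow> bool" where
  "L f a b \<longleftrightarrow> isom f a b \<and> isL (f ` {a..b})"

lemma L_isom: "L f a b \<Longrightarrow> isom f a b"
  by (simp add: L_def)

lemma L_restrict: "L f a b \<Longrightarrow> a \<le> s \<Longrightarrow> s \<le> t \<Longrightarrow> t \<le> b \<Longrightarrow> L f s t"
  unfolding L_def using L_sub isom_sub by blast

lemma L_cong: "(\<And>t. a \<le> t \<Longrightarrow> t \<le> b \<Longrightarrow> f t = g t) \<Longrightarrow> L f a b \<longleftrightarrow> L g a b"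
  unfolding L_def using isom_cong[of a b f g] image_cong[of "{a..b}" "{a..b}" f g] by auto

lemma L_path:
  assumes "p \<in> M" "q \<in> M" "b - a = d p q"
  obtains f where "L f a b" "f a = p" "f b = q"
proof -
  obtain K where "seg p q K" "isL K" using L_ex assms by blast
  then show thesis using seg_param[OF _ assms(3)] that unfolding L_def by metis
qed

lemma good_cong:
  assumes "\<And>v. a \<le> v \<Longrightarrow> v \<le> b \<Longrightarrow> f v = f' v" "good f g a b"
  shows "good f' g a b"
  unfolding good_def
proof (intro allI impI, elim conjE)
  fix s t assume st: "a \<le> s" "s < t" "t \<le> b" "f' s = g s" "f' t = g t"
    and n: "\<forall>v. s < v \<and> v < t \<longrightarrow> f' v \<noteq> g v"
  have "f ` {s..t} = f' ` {s..t}" using assms(1) st by (intro image_cong) auto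
  moreover have "f s = g s" "f t = g t" "\<forall>v. s < v \<and> v < t \<longrightarrow> f v \<noteq> g v"
    using assms(1) st n by auto
  ultimately show "\<exists>A\<in>\<A>. f' ` {s..t} \<union> g ` {s..t} \<subseteq> A"
    using assms(2) st unfolding good_def by metis
qed

text \<open>The break point \<open>f c\<close> serves as third vertex: the bigon becomes a simple
  triangle with limit edges and \<open>Pi3\<close> applies. The edges meet only at vertices because
  \<open>f\<close> and \<open>h\<close>, starting at the same point, can meet only at equal
  parameters.\<close>

lemma simple_bigon_broken:
  assumes h: "L h s t" and f: "isom f s t" "L f s c" "L f c t" and c: "s < c" "c < t"
    and e: "f s = h s" "f t = h t" and n: "\<And>v. s < v \<Longrightarrow> v < t \<Longrightarrow> f v \<noteq> h v"
  shows "\<exists>A\<in>\<A>. f ` {s..t} \<union> h ` {s..t} \<subseteq> A"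
proof -
  have hi: "isom h s t" using h by (rule L_isom)
  have eq: "u = v" if "f u = h v" "s \<le> u" "u \<le> t" "s \<le> v" "v \<le> t" for u v
    using isom_eq_left[OF f(1) hi e(1)] that by blast
  have inj: "u = v" if "f u = f v" "s \<le> u" "u \<le> t" "s \<le> v" "v \<le> t" for u v
    using isom_inj[OF f(1)] that by blast
  have "tri (f s) (f c) (f t) (f ` {s..c}) (f ` {c..t}) (h ` {s..t})"
    unfolding tri_def
  proof (intro conjI)
    show "seg (f s) (f c) (f ` {s..c})" "seg (f c) (f t) (f ` {c..t})"
      using c by (auto intro!: seg_image isom_sub[OF f(1)])
    show "seg (f t) (f s) (h ` {s..t})" using seg_sym[OF seg_image[OF hi]] c e by simp
    show "f s \<noteq> f c" "f c \<noteq> f t" "f t \<noteq> f s" using inj[of s c] inj[of c t] inj[of t s] c by auto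
    show "f ` {s..c} \<inter> f ` {c..t} = {f c}"
    proof (rule image_Int_singleton[of c _ c])
      fix u v assume "u \<in> {s..c}" "v \<in> {c..t}" "f u = f v"
      then show "f u = f c" using inj[of u v] c by (cases "u = c") auto
    qed (use c in auto)
    show "f ` {c..t} \<inter> h ` {s..t} = {f t}"
    proof (rule image_Int_singleton[of t _ t])
      fix u v assume "u \<in> {c..t}" "v \<in> {s..t}" "f u = h v"
      then show "f u = f t" using eq[of u v] n[of u] c by (cases "u = t") auto
    qed (use c e in auto)
    show "h ` {s..t} \<inter> f ` {s..c} = {f s}"
    proof (rule image_Int_singleton[of s _ s])
      fix v u assume "v \<in> {s..t}" "u \<in> {s..c}" "h v = f u"
      then have fu: "f u = h v" "s \<le> u" "u \<le> c" "s \<le> v" "v \<le> t" by simp_all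
      moreover from this have "u = v" using eq[of u v] c by linarith
      ultimately have "u = s" using n[of u] c by (cases "s < u") simp_all
      then show "h v = f s" using fu by simp
    qed (use c e in auto)
  qed
  then obtain A where "A \<in> \<A>" "f ` {s..c} \<union> f ` {c..t} \<union> h ` {s..t} \<subseteq> A"
    using Pi3 f(2,3) h unfolding L_def by metis
  moreover have "{s..t} = {s..c} \<union> {c..t}" using c by auto
  ultimately show ?thesis by (metis image_Un)
qed

lemma good_broken:
  assumes h: "L h a b" and f: "isom f a b" "L f a c" "L f c b" "a \<le> c" "c \<le> b"
  shows "good f h a b"
  unfolding good_def
proof (intro allI impI, elim conjE)
  fix s t assume st: "a \<le> s" "s < t" "t \<le> b" "f s = h s" "f t = h t"
    and n: "\<forall>v. s < v \<and> v < t \<longrightarrow> f v \<noteq> h v"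
  \<comment> \<open>If \<open>c\<close> is not strictly inside the bigon, \<open>f\<close> is a
    single limit geodesic there and any interior parameter can be taken as break point.\<close>
  obtain m where "s < m" "m < t" "L f s m" "L f m t"
  proof -
    obtain m where m: "s < m" "m < t" using dense st by blast
    consider "t \<le> c" | "c \<le> s" | "s < c" "c < t" by linarith
    then show thesis
    proof cases
      case 1
      then show thesis using that[of m] m st L_restrict[OF f(2)] by auto
    next
      case 2
      then show thesis using that[of m] m st L_restrict[OF f(3)] by auto
    next
      case 3
      then show thesis using that[of c] st L_restrict[OF f(2)] L_restrict[OF f(3)] by auto
    qed
  qed
  then show "\<exists>A\<in>\<A>. f ` {s..t} \<union> h ` {s..t} \<subseteq> A"
    using simple_bigon_broken[of h s t f m] L_restrict[OF h] isom_sub[OF f(1)] st n by auto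
qed

text \<open>The property of piecewise limit geodesics that is propagated by appending a limit geodesic.\<close>

definition tame :: "(real \<Rightarrow> 'a) \<Rightarrow> real \<Rightarrow> real \<Rightarrow> bool" where
  "tame f a b \<longleftrightarrow> isom f a b \<and> (\<forall>s t h. a \<le> s \<and> t \<le> b \<and> L h s t \<longrightarrow> good f h s t)"

lemma tame_cong:
  assumes "\<And>v. a \<le> v \<Longrightarrow> v \<le> b \<Longrightarrow> f v = g v" "tame f a b"
  shows "tame g a b"
  using assms(2) isom_cong[of a b f g] good_cong[of _ _ f g] assms(1) unfolding tame_def
  by (smt (verit, best))

text \<open>Only a bigon that straddles \<open>c\<close> is new. There the part of \<open>f\<close>
  before \<open>c\<close> is replaced by one limit geodesic, and the resulting path
  \<open>\<phi>\<close> is compared with both \<open>f\<close> and \<open>h\<close> by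
  \<open>sandwich\<close>.\<close>

lemma tame_step:
  assumes f: "tame f a c" "L f c b" "isom f a b" and c: "a \<le> c" "c \<le> b"
  shows "tame f a b"
  unfolding tame_def
proof (intro conjI allI impI, rule f(3), elim conjE)
  fix s' t' h assume h': "a \<le> s'" "t' \<le> b" "L h s' t'"
  show "good f h s' t'"
    unfolding good_def
  proof (intro allI impI, elim conjE)
    fix s t assume st': "s' \<le> s" "s < t" "t \<le> t'" and e: "f s = h s" "f t = h t"
      and n: "\<forall>v. s < v \<and> v < t \<longrightarrow> f v \<noteq> h v"
    have st: "a \<le> s" "s < t" "t \<le> b" and h: "L h s t" using h' st' L_restrict[OF h'(3)] by auto
    have fi: "isom f s t" using isom_sub[OF f(3)] st by auto
    consider "t \<le> c" | "c \<le> s" | "s < c" "c < t" by linarith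
    then show "\<exists>A\<in>\<A>. f ` {s..t} \<union> h ` {s..t} \<subseteq> A"
    proof cases
      case 1
      then have "good f h s t" using f(1) h st unfolding tame_def by auto
      then show ?thesis using e n st unfolding good_def by auto
    next
      case 2
      \<comment> \<open>\<open>good_broken\<close> is used with the break at \<open>s\<close>, so
        that the first limit part is a single point.\<close>
      then have "good f h s t"
        using good_broken[OF h fi, of s] L_restrict[OF f(2), of s s] L_restrict[OF f(2), of s t] st by auto
      then show ?thesis using e n st unfolding good_def by auto
    next
      case 3
      have "f s \<in> M" "f c \<in> M" "c - s = d (f s) (f c)"
        using isom_in[OF f(3)] isom_dist[OF f(3), of s c] st c 3 by auto
      then obtain k where k: "L k s c" "k s = f s" "k c = f c" using L_path by blast
      \<comment> \<open>\<open>\<phi>\<close> is broken only at \<open>c\<close>, so its bigons with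
        \<open>h\<close> are settled by \<open>good_broken\<close>; its bigons with \<open>f\<close>
        come from the part before \<open>c\<close>, where \<open>f\<close> is tame.\<close>
      define \<phi> where "\<phi> = (\<lambda>u. if u \<le> c then k u else f u)"
      have \<phi>: "isom \<phi> s t"
        unfolding \<phi>_def
      proof (rule isom_concat[OF L_isom[OF k(1)]])
        show "isom f c t" using isom_sub[OF f(3)] st c by auto
        show "d (k s) (f t) = t - s" using isom_dist[OF f(3), of s t] st k by auto
      qed (use k 3 in auto)
      have "L \<phi> s c" using L_cong[of s c \<phi> k] k(1) by (auto simp: \<phi>_def)
      moreover have "L \<phi> c t"
        using L_cong[of c t \<phi> f] L_restrict[OF f(2), of c t] k 3 st by (auto simp: \<phi>_def)
      ultimately have gh: "good \<phi> h s t" using good_broken[OF h \<phi>] 3 by auto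
      have gf: "good \<phi> f s t"
        unfolding good_def
      proof (intro allI impI, elim conjE)
        fix p q assume pq: "s \<le> p" "p < q" "q \<le> t" "\<phi> p = f p" "\<phi> q = f q"
          and npq: "\<forall>v. p < v \<and> v < q \<longrightarrow> \<phi> v \<noteq> f v"
        \<comment> \<open>Beyond \<open>c\<close> the paths \<open>\<phi>\<close> and
          \<open>f\<close> coincide, so no bigon between them reaches past \<open>c\<close>.\<close>
        have "q \<le> c"
        proof (rule ccontr)
          assume "\<not> q \<le> c"
          then obtain w where "max p c < w" "w < q" using dense[of "max p c" q] pq by auto
          then show False using npq by (auto simp: \<phi>_def)
        qed
        have "good k f s c" using f(1) k(1) st 3 good_sym unfolding tame_def by auto
        moreover have "k p = f p" "k q = f q" "\<forall>v. p < v \<and> v < q \<longrightarrow> k v \<noteq> f v"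
          using pq npq \<open>q \<le> c\<close> by (auto simp: \<phi>_def)
        ultimately have "\<exists>A\<in>\<A>. k ` {p..q} \<union> f ` {p..q} \<subseteq> A"
          using pq \<open>q \<le> c\<close> unfolding good_def by auto
        moreover have "\<phi> ` {p..q} = k ` {p..q}" using \<open>q \<le> c\<close> by (auto simp: \<phi>_def)
        ultimately show "\<exists>A\<in>\<A>. \<phi> ` {p..q} \<union> f ` {p..q} \<subseteq> A" by simp
      qed
      show ?thesis
        by (rule sandwich[OF \<phi> fi L_isom[OF h] st(2) _ _ _ _ gf gh]) (use k e n 3 in \<open>auto simp: \<phi>_def\<close>)
    qed
  qed
qed

text \<open>Consecutive points of a partition of \<open>g\<close> are joined by limit geodesics. The
  concatenation is a geodesic because its length equals the distance between its ends, and
  \<open>tame_step\<close> keeps it tame as each part is appended.\<close>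

lemma tame_approx:
  assumes "0 < \<epsilon>" "a \<le> b" "isom g a b"
  shows "\<exists>\<phi>. tame \<phi> a b \<and> \<phi> a = g a \<and> \<phi> b = g b \<and> (\<forall>u. a \<le> u \<and> u \<le> b \<longrightarrow> d (\<phi> u) (g u) < \<epsilon>)"
proof -
  \<comment> \<open>\<open>\<eta>\<close> bounds the mesh. On one step both paths stay within
    \<open>\<eta>\<close> of the left partition point, so they differ by at most
    \<open>2 * \<eta>\<close>, which is less than \<open>\<epsilon>\<close>.\<close>
  define \<eta> where "\<eta> = \<epsilon> / 3"
  have \<eta>: "0 < \<eta>" "2 * \<eta> < \<epsilon>" using assms by (auto simp: \<eta>_def)
  have "\<exists>\<phi>. tame \<phi> a b \<and> \<phi> a = g a \<and> \<phi> b = g b \<and> (\<forall>u. a \<le> u \<and> u \<le> b \<longrightarrow> d (\<phi> u) (g u) < \<epsilon>)"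
    if "a \<le> b" "b - a \<le> real n * \<eta>" "isom g a b" for n
    using that
  proof (induction n arbitrary: b)
    case 0
    then have "b = a" by auto
    then show ?case
      using 0 \<open>0 < \<epsilon>\<close> by (intro exI[of _ g]) (auto simp: tame_def good_def isom_def)
  next
    case (Suc n)
    \<comment> \<open>The last step is split off; \<open>max\<close> allows for a remainder shorter
      than \<open>\<eta>\<close>.\<close>
    define c where "c = max a (b - \<eta>)"
    have c: "a \<le> c" "c \<le> b" "c - a \<le> real n * \<eta>" "b - c \<le> \<eta>"
      using Suc \<eta> by (auto simp: c_def algebra_simps)
    have gc: "isom g a c" using isom_sub[OF Suc.prems(3)] c by auto
    obtain \<psi> where \<psi>: "tame \<psi> a c" "\<psi> a = g a" "\<psi> c = g c"
      "\<And>u. a \<le> u \<Longrightarrow> u \<le> c \<Longrightarrow> d (\<psi> u) (g u) < \<epsilon>"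
      using Suc.IH[OF c(1,3) gc] by blast
    have "g c \<in> M" "g b \<in> M" "b - c = d (g c) (g b)"
      using isom_in[OF Suc.prems(3)] isom_dist[OF Suc.prems(3), of c b] c by auto
    then obtain k where k: "L k c b" "k c = g c" "k b = g b" using L_path by blast
    define \<phi> where "\<phi> = (\<lambda>u. if u \<le> c then \<psi> u else k u)"
    have "isom \<psi> a c" using \<psi> by (auto simp: tame_def)
    then have \<phi>: "isom \<phi> a b"
      unfolding \<phi>_def using isom_dist[OF Suc.prems(3), of a b] c \<psi> k
      by (intro isom_concat[OF _ L_isom[OF k(1)]]) auto
    have "tame \<phi> a c" using tame_cong[of a c \<psi> \<phi>] \<psi>(1) by (auto simp: \<phi>_def)
    moreover have "L \<phi> c b" using L_cong[of c b \<phi> k] k \<psi> by (auto simp: \<phi>_def)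
    ultimately have "tame \<phi> a b" using tame_step \<phi> c by auto
    moreover have "d (\<phi> u) (g u) < \<epsilon>" if u: "a \<le> u" "u \<le> b" for u
    proof (cases "u \<le> c")
      case True
      then show ?thesis using \<psi>(4) u by (auto simp: \<phi>_def)
    next
      case False
      have M: "k u \<in> M" "g c \<in> M" "g u \<in> M" 
        using isom_in[OF Suc.prems(3)] isom_in[OF L_isom[OF k(1)]] u c False by auto
      have "d (k u) (g c) = u - c" "d (g c) (g u) = u - c"
        using isom_dist[OF Suc.prems(3), of c u] isom_dist[OF L_isom[OF k(1)], of u c] u c k False by auto
      then show ?thesis using triangle[OF M] False u c(4) \<eta> by (simp add: \<phi>_def)
    qed
    moreover have "\<phi> a = g a" "\<phi> b = g b" using \<psi> k c by (auto simp: \<phi>_def)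
    ultimately show ?case by blast
  qed
  moreover obtain n where "(b - a) / \<eta> \<le> real n" using real_arch_simple by blast
  ultimately show ?thesis using assms \<eta> by (auto simp: field_simps)
qed

text \<open>Away from its two vertices the bigon has a positive width \<open>m\<close>.
  Approximations of \<open>g\<close> finer than \<open>m\<close> still avoid \<open>h\<close> there,
  hence form simple bigons with \<open>h\<close> that contain the whole part in question; closedness
  of the piece permits the passage to the limit.\<close>

lemma bigon_compact_part:
  assumes g: "isom g s t" and h: "L h s t" and e: "g s = h s" "g t = h t"
    and n: "\<And>v. s < v \<Longrightarrow> v < t \<Longrightarrow> g v \<noteq> h v"
    and s0: "s < s0" "s0 < t0" "t0 < t"
  shows "\<exists>A\<in>\<A>. g ` {s0..t0} \<union> h ` {s0..t0} \<subseteq> A"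
proof -
  have hi: "isom h s t" using h by (rule L_isom)
  have gM: "g v \<in> M" and hM: "h v \<in> M" if "s0 \<le> v" "v \<le> t0" for v
    using isom_in[OF g] isom_in[OF hi] that s0 by auto
  obtain w where w: "w \<in> {s0..t0}" "\<And>v. v \<in> {s0..t0} \<Longrightarrow> d (g w) (h w) \<le> d (g v) (h v)"
  proof -
    have "continuous_on {s0..t0} (\<lambda>v. d (g v) (h v))"
      using isom_dist_continuous[OF isom_sub[OF g] isom_sub[OF hi], of s0 t0] s0 by simp
    then show thesis
      using continuous_attains_inf[of "{s0..t0}" "\<lambda>v. d (g v) (h v)"] s0 that by auto
  qed
  define m where "m = d (g w) (h w)"
  have m: "0 < m" using n[of w] w(1) s0 gM[of w] hM[of w] by (auto simp: m_def)
  have near: "\<exists>A\<in>\<A>. h ` {s0..t0} \<subseteq> A \<and> (\<forall>v\<in>{s0..t0}. \<exists>y\<in>A. d (g v) y < \<epsilon>)" if \<epsilon>: "0 < \<epsilon>" "\<epsilon> \<le> m" for \<epsilon>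
  proof -
    obtain \<phi> where \<phi>: "tame \<phi> s t" "\<phi> s = g s" "\<phi> t = g t"
      "\<And>u. s \<le> u \<Longrightarrow> u \<le> t \<Longrightarrow> d (\<phi> u) (g u) < \<epsilon>"
      using tame_approx[OF \<epsilon>(1) _ g] s0 by auto
    have \<phi>i: "isom \<phi> s t" using \<phi>(1) by (simp add: tame_def)
    \<comment> \<open>The distance from \<open>\<phi> v\<close> to \<open>g v\<close> is below
      \<open>m\<close>, the distance from \<open>g v\<close> to \<open>h v\<close> at least
      \<open>m\<close>. So the gap around \<open>s0\<close> found next extends past
      \<open>t0\<close>.\<close>
    have ne: "\<phi> v \<noteq> h v" if "v \<in> {s0..t0}" for v
      using \<phi>(4)[of v] w(2)[OF that] \<open>\<epsilon> \<le> m\<close> that s0 commute[of "\<phi> v" "g v"] by (auto simp: m_def)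
    obtain s1 t1 where st1: "s \<le> s1" "s1 < s0" "s0 < t1" "t1 \<le> t" "\<phi> s1 = h s1" "\<phi> t1 = h t1"
      "\<And>v. s1 < v \<Longrightarrow> v < t1 \<Longrightarrow> \<phi> v \<noteq> h v"
      using isom_gap[OF \<phi>i hi, of s0] ne[of s0] s0 \<phi> e by auto
    have "t0 < t1" using ne[of t1] st1 by force
    have "good \<phi> h s t" using \<phi>(1) h by (simp add: tame_def)
    then obtain A where A: "A \<in> \<A>" "\<phi> ` {s1..t1} \<union> h ` {s1..t1} \<subseteq> A"
      using st1 unfolding good_def by (meson order_less_trans)
    have sub: "{s0..t0} \<subseteq> {s1..t1}" using st1 \<open>t0 < t1\<close> by auto
    show ?thesis
    proof (intro bexI[OF _ A(1)] conjI ballI)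
      show "h ` {s0..t0} \<subseteq> A" using A(2) sub by blast
      fix v assume v: "v \<in> {s0..t0}"
      then show "\<exists>y\<in>A. d (g v) y < \<epsilon>"
        using A(2) sub \<phi>(4)[of v] s0 commute[of "\<phi> v" "g v"] by (intro bexI[of _ "\<phi> v"]) auto
    qed
  qed
  obtain A where A: "A \<in> \<A>" "h ` {s0..t0} \<subseteq> A" using near[of m] m by auto
  have "g v \<in> A" if v: "v \<in> {s0..t0}" for v
  proof (rule piece_limit[OF A(1)])
    show "g v \<in> M" using gM v by auto
    fix \<epsilon> :: real assume "0 < \<epsilon>"
    then obtain B where B: "B \<in> \<A>" "h ` {s0..t0} \<subseteq> B" "\<exists>y\<in>B. d (g v) y < min \<epsilon> m"
      using near[of "min \<epsilon> m"] m v by auto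
    \<comment> \<open>Both pieces contain the arc of \<open>h\<close> over \<open>{s0..t0}\<close>,
      so refining the approximation does not change the piece.\<close>
    have "A = B"
      using A B by (intro piece_eq_isom[OF A(1) B(1) isom_sub[OF hi, of s0 t0]]) (use s0 in auto)
    then show "\<exists>y\<in>A. d (g v) y < \<epsilon>" using B by auto
  qed
  then show ?thesis using A by blast
qed

text \<open>The open bigon is exhausted by compact parts, each in a piece. The pieces are matched
  along \<open>h\<close>, and \<open>g\<close> follows because each of its interior points lies in a
  part that shares an arc of \<open>h\<close> with \<open>A\<close>.\<close>

lemma good_L:
  assumes g: "isom g a b" and h: "L h a b"
  shows "good g h a b"
  unfolding good_def
proof (intro allI impI, elim conjE)
  fix s t assume st: "a \<le> s" "s < t" "t \<le> b" and e: "g s = h s" "g t = h t"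
    and n: "\<forall>v. s < v \<and> v < t \<longrightarrow> g v \<noteq> h v"
  have gi: "isom g s t" and hL: "L h s t" using isom_sub[OF g] L_restrict[OF h] st by auto
  have hi: "isom h s t" using hL by (rule L_isom)
  have part: "\<exists>s0 t0. \<exists>A\<in>\<A>. s < s0 \<and> s0 < u \<and> u < t0 \<and> t0 < t \<and> g ` {s0..t0} \<union> h ` {s0..t0} \<subseteq> A"
    if u: "s < u" "u < t" for u
  proof -
    obtain s0 where "s < s0" "s0 < u" using dense u by blast
    moreover obtain t0 where "u < t0" "t0 < t" using dense u by blast
    ultimately show ?thesis
      using bigon_compact_part[OF gi hL e, of s0 t0] n by (metis order_less_trans)
  qed
  obtain A where A: "A \<in> \<A>" "h ` {s..t} \<subseteq> A"
  proof (rule one_piece[OF hi st(2)])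
    fix u assume "s < u" "u < t"
    then obtain s0 t0 A where "A \<in> \<A>" "s < s0" "s0 < u" "u < t0" "t0 < t" "g ` {s0..t0} \<union> h ` {s0..t0} \<subseteq> A"
      using part by blast
    then show "\<exists>s' t'. \<exists>A\<in>\<A>. s \<le> s' \<and> s' < u \<and> u < t' \<and> t' \<le> t \<and> (\<forall>v. s' < v \<and> v < t' \<longrightarrow> h v \<in> A)"
      by (intro exI[of _ s0] exI[of _ t0] bexI[of _ A]) auto
  qed
  have "g u \<in> A" if u: "s \<le> u" "u \<le> t" for u
  proof (cases "s < u \<and> u < t")
    case True
    then obtain s0 t0 B where B: "B \<in> \<A>" "s < s0" "s0 < u" "u < t0" "t0 < t" "g ` {s0..t0} \<union> h ` {s0..t0} \<subseteq> B"
      using part by blast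
    have "A = B"
    proof (rule piece_eq_isom[OF A(1) B(1)])
      show "isom h s0 t0" using isom_sub[OF hi] B by auto
    qed (use A B in auto)
    then show ?thesis using B by auto
  next
    case False
    then have "g u = h u" using u e by auto
    then show ?thesis using A u by (metis atLeastAtMost_iff image_subset_iff)
  qed
  then have "g ` {s..t} \<subseteq> A" by (intro image_subsetI) simp
  then show "\<exists>A\<in>\<A>. g ` {s..t} \<union> h ` {s..t} \<subseteq> A" using A by (intro bexI[of _ A] Un_least)
qed

text \<open>A limit geodesic \<open>k\<close> joining the two vertices of the bigon forms bigons
  with each edge that \<open>good_L\<close> settles, so \<open>k\<close> can play the middle path of
  \<open>sandwich\<close>.\<close>

lemma good_isom:
  assumes f: "isom f a b" and g: "isom g a b"
  shows "good f g a b"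
  unfolding good_def
proof (intro allI impI, elim conjE)
  fix s t assume st: "a \<le> s" "s < t" "t \<le> b" and e: "f s = g s" "f t = g t"
    and n: "\<forall>v. s < v \<and> v < t \<longrightarrow> f v \<noteq> g v"
  have fi: "isom f s t" and gi: "isom g s t" using isom_sub[OF f] isom_sub[OF g] st by auto
  have "f s \<in> M" "f t \<in> M" "t - s = d (f s) (f t)"
    using isom_in[OF fi] isom_dist[OF fi, of s t] st by auto
  then obtain k where k: "L k s t" "k s = f s" "k t = f t" using L_path by blast
  show "\<exists>A\<in>\<A>. f ` {s..t} \<union> g ` {s..t} \<subseteq> A"
    by (rule sandwich[OF L_isom[OF k(1)] fi gi st(2) _ _ _ _ good_sym[OF good_L[OF fi k(1)]]
          good_sym[OF good_L[OF gi k(1)]]]) (use k e n in auto)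
qed

lemma bigon_piece:
  assumes "seg x y F" "seg x y G" "x \<noteq> y" "F \<inter> G = {x, y}"
  shows "\<exists>A\<in>\<A>. F \<union> G \<subseteq> A"
proof -
  define l where "l = d x y"
  have l: "0 < l" using seg_ends[OF assms(1)] assms(3) by (auto simp: l_def)
  obtain f where f: "isom f 0 l" "f 0 = x" "f l = y" "f ` {0..l} = F"
    using seg_param[OF assms(1), of l 0] by (auto simp: l_def)
  obtain g where g: "isom g 0 l" "g 0 = x" "g l = y" "g ` {0..l} = G"
    using seg_param[OF assms(2), of l 0] by (auto simp: l_def)
  have "f v \<noteq> g v" if v: "0 < v" "v < l" for v
  proof
    assume eq: "f v = g v"
    have "f v \<in> F" "g v \<in> G" unfolding f(4)[symmetric] g(4)[symmetric] using v by auto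
    then have "f v = f 0 \<or> f v = f l" using eq assms(4) f by auto
    then show False using isom_inj[OF f(1), of v 0] isom_inj[OF f(1), of v l] v by auto
  qed
  then show ?thesis using goodD[OF good_isom[OF f(1) g(1)], of 0 l] l f g by auto
qed

section \<open>Triangles\<close>

text \<open>The flag records whether the edge has already been exchanged for a limit geodesic.\<close>

definition constrained :: "bool \<Rightarrow> 'a set \<Rightarrow> bool" where
  "constrained c K \<longleftrightarrow> (c \<longrightarrow> isL K)"

lemma constrained_restrict:
  "isom f a b \<Longrightarrow> constrained c (f ` {a..b}) \<Longrightarrow> a \<le> s \<Longrightarrow> s \<le> t \<Longrightarrow> t \<le> b \<Longrightarrow> constrained c (f ` {s..t})"
  using L_sub by (auto simp: constrained_def)

text \<open>One exchange: \<open>pieces\<close> is the claim for triangles whose first edge is a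
  limit geodesic. A limit geodesic \<open>k\<close> with the ends of \<open>F\<close> is covered by
  pieces coming from bigons and from smaller triangles, so one piece \<open>A\<close> contains
  \<open>k\<close>; then \<open>A\<close> is shown to contain \<open>F\<close>, \<open>G\<close> and
  \<open>H\<close>.\<close>

lemma tri_replace_edge:
  assumes pieces: "\<And>x y z F G H. tri x y z F G H \<Longrightarrow> isL F \<Longrightarrow> constrained c1 G \<Longrightarrow> constrained c2 H \<Longrightarrow>
      \<exists>A\<in>\<A>. F \<union> G \<union> H \<subseteq> A"
    and T: "tri x y z F G H" and cG: "constrained c1 G" and cH: "constrained c2 H"
  shows "\<exists>A\<in>\<A>. F \<union> G \<union> H \<subseteq> A"
proof -
  have sF: "seg x y F" and sG: "seg y z G" and sH: "seg z x H"
    and ne: "x \<noteq> y" "y \<noteq> z" "z \<noteq> x"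
    and int: "F \<inter> G = {y}" "G \<inter> H = {z}" "H \<inter> F = {x}"
    using T by (auto simp: tri_def)
  have xyz: "x \<in> M" "y \<in> M" "z \<in> M" using seg_ends sF sG by auto
  \<comment> \<open>\<open>lg\<close> and \<open>lh\<close> are the parameters of \<open>z\<close>
    on \<open>g\<close> and \<open>h\<close>; \<open>lg \<le> lh\<close> is the triangle inequality
    for \<open>x\<close>, \<open>z\<close>, \<open>y\<close>.\<close>
  define l lh lg where "l = d x y" and "lh = d x z" and "lg = l - d z y"
  have len: "0 < l" "0 < lh" "lg < l" "lg \<le> lh"
    using xyz ne triangle[of x z y] by (auto simp: l_def lh_def lg_def)
  obtain f where f: "isom f 0 l" "f 0 = x" "f l = y" "f ` {0..l} = F"
    using seg_param[OF sF, of l 0] by (auto simp: l_def)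
  obtain g where g: "isom g lg l" "g lg = z" "g l = y" "g ` {lg..l} = G"
    using seg_param[OF seg_sym[OF sG], of l lg] by (auto simp: lg_def)
  \<comment> \<open>\<open>h\<close> is aligned with \<open>f\<close> at \<open>x\<close> and \<open>g\<close> at \<open>y\<close> (so \<open>lg\<close> may be negative); then the new
    edge meets \<open>g\<close> and \<open>h\<close> only at equal parameters.\<close>
  obtain h where h: "isom h 0 lh" "h 0 = x" "h lh = z" "h ` {0..lh} = H"
    using seg_param[OF seg_sym[OF sH], of lh 0] by (auto simp: lh_def)
  have inF: "f u \<in> F" if "0 \<le> u" "u \<le> l" for u using that f(4) by auto
  have inG: "g u \<in> G" if "lg \<le> u" "u \<le> l" for u using that g(4) by auto
  have inH: "h u \<in> H" if "0 \<le> u" "u \<le> lh" for u using that h(4) by auto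
  have fh: "u = 0" if "f u = h u" "0 \<le> u" "u \<le> l" "u \<le> lh" for u
  proof -
    have "f u = f 0" using inF[of u] inH[of u] that int f(2) by auto
    then show ?thesis using isom_inj[OF f(1), of u 0] that by auto
  qed
  have fg: "u = l" if "f u = g u" "0 \<le> u" "lg \<le> u" "u \<le> l" for u
  proof -
    have "f u = f l" using inF[of u] inG[of u] that int f(3) by auto
    then show ?thesis using isom_inj[OF f(1), of u l] that by auto
  qed
  show ?thesis
  proof (cases "lg = lh")
    case True
    \<comment> \<open>Here \<open>z\<close> lies metrically between \<open>x\<close> and
      \<open>y\<close>, so \<open>H\<close> followed by \<open>G\<close> is a geodesic and the
      triangle is a bigon.\<close>
    define \<phi> where "\<phi> = (\<lambda>u. if u \<le> lh then h u else g u)"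
    have \<phi>: "isom \<phi> 0 l"
      unfolding \<phi>_def using h g len True by (intro isom_concat[OF h(1)]) (auto simp: l_def)
    have "f v \<noteq> \<phi> v" if "0 < v" "v < l" for v
      using fh[of v] fg[of v] that True by (auto simp: \<phi>_def)
    moreover have "f 0 = \<phi> 0" "f l = \<phi> l" using f g h len True by (auto simp: \<phi>_def)
    ultimately obtain A where A: "A \<in> \<A>" "F \<union> \<phi> ` {0..l} \<subseteq> A"
      using goodD[OF good_isom[OF f(1) \<phi>], of 0 l] len f(4) by auto
    have \<phi>A: "\<phi> u \<in> A" if "0 \<le> u" "u \<le> l" for u using A that by auto
    have "\<phi> u = h u" if "u \<le> lh" for u using that by (auto simp: \<phi>_def)
    then have "h u \<in> A" if "0 \<le> u" "u \<le> lh" for u using that len True \<phi>A[of u] by auto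
    moreover have "\<phi> u = g u" if "lg \<le> u" for u using that True g h by (auto simp: \<phi>_def)
    then have "g u \<in> A" if "lg \<le> u" "u \<le> l" for u using that len True \<phi>A[of u] by auto
    ultimately have "H \<subseteq> A" "G \<subseteq> A" unfolding h(4)[symmetric] g(4)[symmetric] by auto
    then show ?thesis using A by auto
  next
    case False
    then have len': "lg < lh" using len by auto
    obtain k where k: "L k 0 l" "k 0 = x" "k l = y"
      using L_path[OF xyz(1,2), of l 0] by (auto simp: l_def)
    have ki: "isom k 0 l" using k(1) by (rule L_isom)
    have kh_eq: "u = v" if "k u = h v" "0 \<le> u" "u \<le> l" "0 \<le> v" "v \<le> lh" for u v
      using isom_eq_left[OF ki h(1), of u v] that k h by auto
    have kg_eq: "u = v" if "k u = g v" "0 \<le> u" "u \<le> l" "lg \<le> v" "v \<le> l" for u v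
      using isom_eq_right[OF ki g(1), of u v] that k g by auto
    \<comment> \<open>Passing through \<open>z\<close> would force the parameter to be both
      \<open>lh\<close> and \<open>lg\<close>.\<close>
    have kz: "k u \<noteq> z" if "0 \<le> u" "u \<le> l" for u
      using kh_eq[of u lh] kg_eq[of u lg] that len len' h g by auto
    \<comment> \<open>The parameters at which the new edge touches \<open>H\<close> and
      \<open>G\<close>. They are disjoint closed sets, since a common point would be
      \<open>z\<close>.\<close>
    define SH where "SH = {t\<in>{0..min l lh}. k t = h t}"
    define SG where "SG = {t\<in>{max 0 lg..l}. k t = g t}"
    have closed: "closed SH" "closed SG"
      unfolding SH_def SG_def
      by (intro isom_agree_closed isom_sub[OF ki] isom_sub[OF h(1)] isom_sub[OF g(1)]; simp)+
    have ends: "0 \<in> SH" "l \<in> SG" using k h g len by (auto simp: SH_def SG_def)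
    have disj: "u \<notin> SG" if "u \<in> SH" for u
    proof
      assume "u \<in> SG"
      then have "k u \<in> G \<inter> H" using that inG[of u] inH[of u] by (auto simp: SH_def SG_def)
      then show False using kz[of u] int that by (auto simp: SH_def)
    qed
    \<comment> \<open>Two neighbouring contacts, one with each edge, cut off a simple triangle with
      apex \<open>z\<close> and a limit base on \<open>k\<close>. The contact with \<open>H\<close>
      may come before or after the one with \<open>G\<close>, whence \<open>min\<close> and
      \<open>max\<close>.\<close>
    have mixed: "\<exists>A\<in>\<A>. k ` {min p q..max p q} \<union> g ` {lg..q} \<union> h ` {p..lh} \<subseteq> A"
      if p: "p \<in> SH" and q: "q \<in> SG"
        and n: "\<And>v. min p q < v \<Longrightarrow> v < max p q \<Longrightarrow> v \<notin> SH \<union> SG" for p q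
    proof (rule pieces)
      have pq: "p \<noteq> q" using disj p q by auto
      have p': "0 \<le> p" "p \<le> l" "p \<le> lh" "k p = h p" and q': "0 \<le> q" "lg \<le> q" "q \<le> l" "k q = g q"
        using p q by (auto simp: SH_def SG_def)
      show "tri (k p) (k q) z (k ` {min p q..max p q}) (g ` {lg..q}) (h ` {p..lh})"
        unfolding tri_def
      proof (intro conjI)
        show "seg (k p) (k q) (k ` {min p q..max p q})"
        proof (cases "p \<le> q")
          case True
          then show ?thesis using seg_image[OF isom_sub[OF ki, of p q]] p' q' by (simp add: min_def max_def)
        next
          case False
          then show ?thesis using seg_sym[OF seg_image[OF isom_sub[OF ki, of q p]]] p' q'
            by (simp add: min_def max_def)
        qed
        show "seg (k q) z (g ` {lg..q})"
          using seg_sym[OF seg_image[OF isom_sub[OF g(1), of lg q]]] q' g by simp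
        show "seg z (k p) (h ` {p..lh})"
          using seg_sym[OF seg_image[OF isom_sub[OF h(1), of p lh]]] p' h by simp
        show "k p \<noteq> k q" using isom_inj[OF ki, of p q] p' q' pq by auto
        show "k q \<noteq> z" "z \<noteq> k p" using kz[of q] kz[of p] p' q' by auto
        show "k ` {min p q..max p q} \<inter> g ` {lg..q} = {k q}"
        proof (rule image_Int_singleton[of q _ q])
          fix u v assume uv: "u \<in> {min p q..max p q}" "v \<in> {lg..q}" "k u = g v"
          then have u: "u = v" using kg_eq[of u v] p' q' by auto
          then have "u \<in> SG" using uv p' q' by (auto simp: SG_def)
          then have "u \<noteq> p" "\<not> (min p q < u \<and> u < max p q)" using n[of u] disj[OF p] by auto
          then have "u = q" using uv(1) by (auto simp: min_def max_def split: if_splits)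
          then show "k u = k q" by simp
        qed (use q' in auto)
        show "g ` {lg..q} \<inter> h ` {p..lh} = {z}"
        proof (rule image_Int_singleton[of lg _ lh])
          fix u v assume uv: "u \<in> {lg..q}" "v \<in> {p..lh}" "g u = h v"
          then have "g u \<in> G" "h v \<in> H" using inG[of u] inH[of v] p' q' by auto
          then show "g u = z" using uv int by auto
        qed (use q' p' g h in auto)
        show "h ` {p..lh} \<inter> k ` {min p q..max p q} = {k p}"
        proof (rule image_Int_singleton[of p _ p])
          fix v u assume uv: "v \<in> {p..lh}" "u \<in> {min p q..max p q}" "h v = k u"
          then have u: "u = v" using kh_eq[of u v] p' q' by auto
          then have "u \<in> SH" using uv p' q' by (auto simp: SH_def)
          then have "u \<noteq> q" "\<not> (min p q < u \<and> u < max p q)" using n[of u] disj[of u] q by auto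
          then have "u = p" using uv(2) by (auto simp: min_def max_def split: if_splits)
          then show "h v = k p" using uv(3) by simp
        qed (use p' in auto)
      qed
      show "isL (k ` {min p q..max p q})"
        using L_restrict[OF k(1), of "min p q" "max p q"] p' q' by (auto simp: L_def)
      show "constrained c1 (g ` {lg..q})"
        using constrained_restrict[OF g(1)] cG g(4) q' by auto
      show "constrained c2 (h ` {p..lh})"
        using constrained_restrict[OF h(1)] cH h(4) p' by auto
    qed
    obtain A where A: "A \<in> \<A>" "k ` {0..l} \<subseteq> A"
    proof (rule one_piece[OF ki len(1)])
      fix u assume u: "0 < u" "u < l"
      \<comment> \<open>Where \<open>k\<close> leaves \<open>f\<close>, a bigon of the two does it.
        Where they agree, \<open>k u\<close> is an interior point of \<open>F\<close> and so off
        \<open>G\<close> and \<open>H\<close>; the surrounding gap between contacts then bounds a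
        bigon with \<open>h\<close> or \<open>g\<close>, or a triangle as in
        \<open>mixed\<close>.\<close>
      have "\<exists>s t. \<exists>A\<in>\<A>. 0 \<le> s \<and> s < u \<and> u < t \<and> t \<le> l \<and> k ` {s..t} \<subseteq> A"
      proof (cases "k u = f u")
        case False
        obtain s t A where "A \<in> \<A>" "0 \<le> s" "s < u" "u < t" "t \<le> l" "k ` {s..t} \<union> f ` {s..t} \<subseteq> A"
          using good_gap[OF ki f(1) _ _ good_isom[OF ki f(1)] False] u k f by (metis less_imp_le)
        then show ?thesis by blast
      next
        case True
        have "u \<notin> SH \<union> SG" using fh[of u] fg[of u] u True by (auto simp: SH_def SG_def)
        moreover have "closed (SH \<union> SG)" "0 \<in> SH \<union> SG" "l \<in> SH \<union> SG" "0 \<le> u" "u \<le> l"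
          using closed ends u by auto
        ultimately obtain s t where st: "s \<in> SH \<union> SG" "t \<in> SH \<union> SG" "0 \<le> s" "s < u" "u < t" "t \<le> l"
          "\<And>v. s < v \<Longrightarrow> v < t \<Longrightarrow> v \<notin> SH \<union> SG"
          using closed_gap[of "SH \<union> SG" 0 l u] by blast
        have "\<exists>A\<in>\<A>. k ` {s..t} \<subseteq> A"
        proof -
          consider "s \<in> SH" "t \<in> SH" | "s \<in> SG" "t \<in> SG" | "s \<in> SH" "t \<in> SG" | "s \<in> SG" "t \<in> SH"
            using st by auto
          then show ?thesis
          proof cases
            case 1
            have "good k h s t"
              using 1 isom_sub[OF ki] isom_sub[OF h(1)] by (intro good_isom) (auto simp: SH_def)
            moreover have "k v \<noteq> h v" if "s < v" "v < t" for v
              using st(7)[OF that] that 1 by (auto simp: SH_def)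
            ultimately have "\<exists>A\<in>\<A>. k ` {s..t} \<union> h ` {s..t} \<subseteq> A"
              using goodD[of k h s t s t] 1 st(4,5) unfolding SH_def by auto
            then show ?thesis by auto
          next
            case 2
            have "good k g s t"
              using 2 isom_sub[OF ki] isom_sub[OF g(1)] by (intro good_isom) (auto simp: SG_def)
            moreover have "k v \<noteq> g v" if "s < v" "v < t" for v
              using st(7)[OF that] that 2 by (auto simp: SG_def)
            ultimately have "\<exists>A\<in>\<A>. k ` {s..t} \<union> g ` {s..t} \<subseteq> A"
              using goodD[of k g s t s t] 2 st(4,5) unfolding SG_def by auto
            then show ?thesis by auto
          next
            case 3
            then show ?thesis using mixed[of s t] st by (auto simp: min_def max_def)
          next
            case 4
            then show ?thesis using mixed[of t s] st by (auto simp: min_def max_def)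
          qed
        qed
        then show ?thesis using st by blast
      qed
      then obtain s t A where "A \<in> \<A>" "0 \<le> s" "s < u" "u < t" "t \<le> l" "k ` {s..t} \<subseteq> A" by blast
      then show "\<exists>s t. \<exists>A\<in>\<A>. 0 \<le> s \<and> s < u \<and> u < t \<and> t \<le> l \<and> (\<forall>v. s < v \<and> v < t \<longrightarrow> k v \<in> A)"
        by (intro exI[of _ s] exI[of _ t] bexI[of _ A]) auto
    qed
    have kA: "k u \<in> A" if "0 \<le> u" "u \<le> l" for u using A that by auto
    have FA: "F \<subseteq> A"
      using good_transfer[OF ki f(1) _ _ good_isom[OF ki f(1)] A] k f by auto
    \<comment> \<open>\<open>t\<close> is the first contact with \<open>G\<close> and
      \<open>s\<close> below the last contact with \<open>H\<close> before it. The triangle they cut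
      off contains the parts of \<open>G\<close> and \<open>H\<close> next to \<open>z\<close>; the
      remaining parts share both ends with a part of \<open>k\<close> and are reached by
      \<open>good_transfer\<close>.\<close>
    obtain t where t: "t \<in> SG" "\<And>v. v \<in> SG \<Longrightarrow> t \<le> v"
    proof -
      have "SG = SG \<inter> {0..l}" by (auto simp: SG_def)
      then have "compact SG" using closed(2) closed_Int_compact[of SG "{0..l}"] by simp
      then show thesis using compact_attains_inf[of SG] ends that by blast
    qed
    obtain s where s: "s \<in> SH" "s \<le> t" "\<And>v. v \<in> SH \<Longrightarrow> v \<le> t \<Longrightarrow> v \<le> s"
    proof -
      have "compact (SH \<inter> {0..t})" using closed(1) by (intro closed_Int_compact) auto
      moreover have "0 \<in> SH \<inter> {0..t}" using ends t(1) by (auto simp: SG_def)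
      ultimately obtain s where "s \<in> SH \<inter> {0..t}" "\<And>v. v \<in> SH \<inter> {0..t} \<Longrightarrow> v \<le> s"
        using compact_attains_sup[of "SH \<inter> {0..t}"] by blast
      then show thesis using that[of s] by (auto simp: SH_def)
    qed
    have "s < t" using s(1,2) t(1) disj[of s] by (cases "s = t") auto
    have "v \<notin> SH \<union> SG" if "s < v" "v < t" for v using s(3)[of v] t(2)[of v] that by auto
    then obtain B where B: "B \<in> \<A>" "k ` {s..t} \<union> g ` {lg..t} \<union> h ` {s..lh} \<subseteq> B"
      using mixed[OF s(1) t(1)] \<open>s < t\<close> by (auto simp: min_def max_def)
    have st: "0 \<le> s" "s \<le> l" "s \<le> lh" "k s = h s" "0 \<le> t" "lg \<le> t" "t \<le> l" "k t = g t"
      using s t by (auto simp: SH_def SG_def)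
    have "A = B"
    proof (rule piece_eq_isom[OF A(1) B(1) isom_sub[OF ki, of s t] \<open>s < t\<close>])
      show "k v \<in> B" if "s < v" "v < t" for v using B(2) that by auto
    qed (use st kA in auto)
    have "h ` {0..s} \<subseteq> A"
    proof (rule good_transfer[OF _ _ _ _ good_isom A(1), of k])
      show "isom k 0 s" "isom h 0 s" using st by (auto intro: isom_sub[OF ki] isom_sub[OF h(1)])
      show "k ` {0..s} \<subseteq> A" using kA st by auto
    qed (use st k h in \<open>auto intro: isom_sub[OF ki] isom_sub[OF h(1)]\<close>)
    moreover have "g ` {t..l} \<subseteq> A"
    proof (rule good_transfer[OF _ _ _ _ good_isom A(1), of k])
      show "isom k t l" "isom g t l" using st by (auto intro: isom_sub[OF ki] isom_sub[OF g(1)])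
      show "k ` {t..l} \<subseteq> A" using kA st by auto
    qed (use st k g in \<open>auto intro: isom_sub[OF ki] isom_sub[OF g(1)]\<close>)
    moreover have "H = h ` {0..s} \<union> h ` {s..lh}" "G = g ` {lg..t} \<union> g ` {t..l}"
      unfolding h(4)[symmetric] g(4)[symmetric] image_Un[symmetric] using st
      by (simp_all add: ivl_disj_un_two_touch)
    ultimately have "F \<union> G \<union> H \<subseteq> A" using FA B(2) \<open>A = B\<close> by simp
    then show ?thesis using A(1) by blast
  qed
qed

text \<open>The hypothesis of two limit edges, then of one, then of none is reached by successive
  exchanges. Rotating twice brings a still arbitrary edge \<open>H\<close> to the front, where the
  previous claim can exchange it.\<close>

theorem tri_piece:
  assumes "tri x y z F G H"
  shows "\<exists>A\<in>\<A>. F \<union> G \<union> H \<subseteq> A"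
proof -
  have 1: "\<exists>A\<in>\<A>. F \<union> G \<union> H \<subseteq> A" if "tri x y z F G H" "isL G" "isL H" for x y z F G H
    using tri_replace_edge[of True True, OF _ that(1)] Pi3 that by (auto simp: constrained_def)
  have 2: "\<exists>A\<in>\<A>. F \<union> G \<union> H \<subseteq> A" if "tri x y z F G H" "isL G" for x y z F G H
  proof (rule tri_replace_edge[of True False, OF _ that(1)])
    fix x y z F G H assume "tri x y z F G H" "isL F" "constrained True G"
    then show "\<exists>A\<in>\<A>. F \<union> G \<union> H \<subseteq> A"
      using 1[OF tri_rotate[OF tri_rotate]] by (simp add: constrained_def Un_ac)
  qed (use that in \<open>auto simp: constrained_def\<close>)
  show ?thesis
  proof (rule tri_replace_edge[of False False, OF _ assms])
    fix x y z F G H assume "tri x y z F G H" "isL F"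
    then show "\<exists>A\<in>\<A>. F \<union> G \<union> H \<subseteq> A"
      using 2[OF tri_rotate[OF tri_rotate]] by (simp add: Un_ac)
  qed (auto simp: constrained_def)
qed

text \<open>Coinciding vertices make the edge between them a point and leave a bigon for
  \<open>bigon_piece\<close>; non-triviality excludes that all three coincide. With distinct
  vertices, simplicity of the loop gives \<open>tri\<close>.\<close>

theorem geodesic_triangle_piece:
  assumes T: "geodesic_triangle M d \<alpha> \<beta> \<gamma>" and S: "simple_triangle \<alpha> \<beta> \<gamma>"
    and N: "nontrivial_triangle \<alpha> \<beta> \<gamma>"
  shows "\<exists>A\<in>\<A>. triangle_set \<alpha> \<beta> \<gamma> \<subseteq> A"
proof -
  obtain a f b g c h where arcs: "\<alpha> = (a, f)" "\<beta> = (b, g)" "\<gamma> = (c, h)"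
    by (metis surj_pair)
  define F G H where "F = arc_image \<alpha>" and "G = arc_image \<beta>" and "H = arc_image \<gamma>"
  define x y z where "x = f 0" and "y = g 0" and "z = h 0"
  have junct: "f a = y" "g b = z" "h c = x" and len: "0 \<le> a" "0 \<le> b" "0 \<le> c"
    using T by (auto simp: arcs x_def y_def z_def geodesic_triangle_def geodesic_def arc_start_def arc_finish_def)
  have f: "isom f 0 a" and g: "isom g 0 b" and h: "isom h 0 c"
    using T by (auto simp: arcs geodesic_triangle_def geodesic_def isom_def)
  have FGH: "F = f ` {0..a}" "G = g ` {0..b}" "H = h ` {0..c}"
    by (simp_all add: F_def G_def H_def arcs arc_image_def)
  have segs: "seg x y F" "seg y z G" "seg z x H"
    using seg_image[OF f] seg_image[OF g] seg_image[OF h] junct len by (simp_all add: FGH x_def y_def z_def)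
  define p where "p = triangle_loop \<alpha> \<beta> \<gamma>"
  have pf: "p s = f s" if "0 \<le> s" "s \<le> a" for s
    using that by (simp add: p_def triangle_loop_def arcs)
  have pg: "p (a + s) = g s" if "0 \<le> s" "s \<le> b" for s
    using that junct by (auto simp: p_def triangle_loop_def arcs y_def)
  have ph: "p (a + b + s) = h s" if "0 \<le> s" "s \<le> c" for s
  proof (cases "s = 0")
    case True
    then show ?thesis using pg[of b] len junct by (simp add: z_def)
  next
    case False
    then show ?thesis using that len by (simp add: p_def triangle_loop_def arcs)
  qed
  have loop_inj: "u = v \<or> u = 0 \<and> v = a + b + c \<or> u = a + b + c \<and> v = 0"
    if uv: "p u = p v" "0 \<le> u" "u \<le> a + b + c" "0 \<le> v" "v \<le> a + b + c" for u v
  proof -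
    have inj: "inj_on p {0..<a + b + c}" using S by (simp add: simple_triangle_def p_def arcs)
    have "p (a + b + c) = p 0" using ph[of c] pf[of 0] len junct by (simp add: x_def)
    then show ?thesis
      using inj_onD[OF inj, of u v] inj_onD[OF inj, of 0 v] inj_onD[OF inj, of u 0] uv by (auto simp: order_le_less)
  qed
  \<comment> \<open>The first alternative is the common vertex. The others can occur only when an
    edge is constant, and they disappear once the vertices are distinct.\<close>
  have fg: "s = a \<and> t = 0 \<or> s = 0 \<and> c = 0 \<and> t = b \<or> s = 0 \<and> a = 0"
    if "f s = g t" "0 \<le> s" "s \<le> a" "0 \<le> t" "t \<le> b" for s t
    using loop_inj[of s "a + t"] pf[of s] pg[of t] that len by auto
  have gh: "s = b \<and> t = 0 \<or> s = 0 \<and> a = 0 \<and> t = c \<or> s = b \<and> b = 0"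
    if "g s = h t" "0 \<le> s" "s \<le> b" "0 \<le> t" "t \<le> c" for s t
    using loop_inj[of "a + s" "a + b + t"] pg[of s] ph[of t] that len by auto
  have hf: "s = c \<and> t = 0 \<or> s = 0 \<and> b = 0 \<and> t = a \<or> s = c \<and> c = 0"
    if "h s = f t" "0 \<le> s" "s \<le> c" "0 \<le> t" "t \<le> a" for s t
    using loop_inj[of "a + b + s" t] ph[of s] pf[of t] that len by auto
  have int: "F \<inter> G \<subseteq> {x, y}" "G \<inter> H \<subseteq> {y, z}" "H \<inter> F \<subseteq> {z, x}"
    unfolding FGH using fg gh hf junct by (fastforce simp: x_def y_def z_def)+
  have "\<exists>A\<in>\<A>. F \<union> G \<union> H \<subseteq> A"
  proof -
    have triv: "x = y \<Longrightarrow> F = {x}" "y = z \<Longrightarrow> G = {y}" "z = x \<Longrightarrow> H = {z}"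
      using segs seg_trivial by auto
    have "\<not> (x = y \<and> y = z)"
      using triv N by (auto simp: nontrivial_triangle_def triangle_set_def F_def G_def H_def)
    have ends: "x \<in> F" "y \<in> F" "y \<in> G" "z \<in> G" "z \<in> H" "x \<in> H" using segs seg_ends by auto
    consider "x = y" "y \<noteq> z" | "y = z" "z \<noteq> x" | "z = x" "x \<noteq> y" | "x \<noteq> y" "y \<noteq> z" "z \<noteq> x"
      using \<open>\<not> (x = y \<and> y = z)\<close> by auto
    then show ?thesis
    proof cases
      case 1
      have "G \<inter> H = {y, z}" using int(2) ends 1 by auto
      then obtain A where "A \<in> \<A>" "G \<union> H \<subseteq> A"
        using bigon_piece[OF segs(2), of H] seg_sym[OF segs(3)] 1 by auto
      then show ?thesis using triv(1) ends 1 by (intro bexI[of _ A]) auto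
    next
      case 2
      have "H \<inter> F = {z, x}" using int(3) ends 2 by auto
      then obtain A where "A \<in> \<A>" "H \<union> F \<subseteq> A"
        using bigon_piece[OF segs(3), of F] seg_sym[OF segs(1)] 2 by auto
      then show ?thesis using triv(2) ends 2 by (intro bexI[of _ A]) auto
    next
      case 3
      have "F \<inter> G = {x, y}" using int(1) ends 3 by auto
      then obtain A where "A \<in> \<A>" "F \<union> G \<subseteq> A"
        using bigon_piece[OF segs(1), of G] seg_sym[OF segs(2)] 3 by auto
      then show ?thesis using triv(3) ends 3 by (intro bexI[of _ A]) auto
    next
      case 4
      then have pos: "a \<noteq> 0" "b \<noteq> 0" "c \<noteq> 0" using junct by (auto simp: x_def y_def z_def)
      have "f 0 \<noteq> g t" if "0 \<le> t" "t \<le> b" for t using fg[of 0 t] that pos len by auto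
      moreover have "g 0 \<noteq> h t" if "0 \<le> t" "t \<le> c" for t using gh[of 0 t] that pos len by auto
      moreover have "h 0 \<noteq> f t" if "0 \<le> t" "t \<le> a" for t using hf[of 0 t] that pos len by auto
      ultimately have "x \<notin> G" "y \<notin> H" "z \<notin> F"
        unfolding FGH x_def y_def z_def by (simp_all add: image_iff)
      then have "F \<inter> G = {y}" "G \<inter> H = {z}" "H \<inter> F = {x}" using int ends by auto
      then show ?thesis using tri_piece[of x y z F G H] segs 4 by (auto simp: tri_def)
    qed
  qed
  then show ?thesis by (simp add: triangle_set_def F_def G_def H_def)
qed

end

section \<open>Limit geodesics in asymptotic cones\<close>

context cone_data
begin

section \<open>Points of the cone and the sequences that represent them\<close>

sublocale C: Metric_space Con D
  by (rule Metric_space_cone)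

abbreviation "P \<equiv> cone_point X \<delta> \<omega> e d"

lemma cone_point_in: "x \<in> S \<Longrightarrow> P x \<in> Con"
  unfolding asymp_cone_def cone_point_def by (rule quotientI)

lemma cone_point_surj: "p \<in> Con \<Longrightarrow> \<exists>x\<in>S. p = P x"
  unfolding asymp_cone_def cone_point_def by (auto elim: quotientE)

lemma cone_point_dist: "x \<in> S \<Longrightarrow> y \<in> S \<Longrightarrow> (q x y \<longlongrightarrow> D (P x) (P y)) \<omega>"
  using cone_dist_lim[OF cone_point_in cone_point_in] equiv_class_self[OF equiv_R]
  unfolding cone_point_def by blast

lemma cone_point_dist_eq:
  assumes "x \<in> S" "y \<in> S" "(q x y \<longlongrightarrow> r) \<omega>" shows "D (P x) (P y) = r"
  using tendsto_unique[OF nonbot cone_point_dist[OF assms(1,2)] assms(3)] .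

lemma cone_point_eq: "x \<in> S \<Longrightarrow> y \<in> S \<Longrightarrow> (q x y \<longlongrightarrow> 0) \<omega> \<Longrightarrow> P x = P y"
  using cone_point_dist_eq[of x y 0] C.zero cone_point_in by auto

lemma cone_seqs_near:
  assumes "x \<in> S" "\<And>n. y n \<in> X" "eventually (\<lambda>n. q x y n \<le> B) \<omega>" shows "y \<in> S"
proof -
  obtain K where K: "eventually (\<lambda>n. q x e n \<le> K) \<omega>" using assms(1) by (auto simp: cone_seqs_def)
  have "eventually (\<lambda>n. q y e n \<le> B + K) \<omega>"
    using K assms(3)
  proof eventually_elim
    case (elim n)
    have "\<delta> (y n) (e n) \<le> \<delta> (x n) (y n) + \<delta> (x n) (e n)"
      using triangle[of "y n" "x n" "e n"] S_X[OF assms(1), of n] assms(2) base commute[of "x n" "y n"] by auto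
    then have "q y e n \<le> (\<delta> (x n) (y n) + \<delta> (x n) (e n)) / d n"
      using scale[of n] by (simp add: divide_right_mono less_imp_le)
    then show ?case using elim by (simp add: add_divide_distrib)
  qed
  then show ?thesis using assms(2) by (auto simp: cone_seqs_def)
qed

definition limit_segment :: "(nat \<Rightarrow> 'a) set set \<Rightarrow> bool" where
  "limit_segment K \<longleftrightarrow> (\<exists>g. (\<forall>n. geodesic X \<delta> (g n)) \<and> K = limit_set X \<delta> \<omega> e d (\<lambda>n. arc_image (g n)))"

text \<open>Representatives of the two points are joined by geodesics \<open>g n\<close> of
  \<open>X\<close>. Their lengths divided by \<open>d n\<close> tend to the distance
  \<open>r\<close>, so following \<open>g n\<close> at speed \<open>d n\<close> becomes an isometric
  path in the limit.\<close>

lemma limit_segment_exists: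
  assumes X: "geodesic_metric_space X \<delta>" and p: "p \<in> Con" "p' \<in> Con"
  shows "\<exists>K. C.seg p p' K \<and> limit_segment K"
proof -
  obtain x y where x: "x \<in> S" "p = P x" and y: "y \<in> S" "p' = P y" using p cone_point_surj by blast
  have "\<exists>\<gamma>. geodesic X \<delta> \<gamma> \<and> arc_start \<gamma> = x n \<and> arc_finish \<gamma> = y n" for n
    using X S_X x(1) y(1) unfolding geodesic_metric_space_def by blast
  then obtain g where g: "\<And>n. geodesic X \<delta> (g n)" "\<And>n. snd (g n) 0 = x n" "\<And>n. snd (g n) (fst (g n)) = y n"
    unfolding arc_start_def arc_finish_def by metis
  define l where "l n = fst (g n)" for n
  have l0: "0 \<le> l n" for n using g(1) by (simp add: geodesic_def l_def)
  have gX: "snd (g n) t \<in> X" if "0 \<le> t" "t \<le> l n" for n t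
    using g(1)[of n] that by (simp add: geodesic_def l_def)
  have gd: "\<delta> (snd (g n) s) (snd (g n) t) = \<bar>s - t\<bar>" if "0 \<le> s" "s \<le> l n" "0 \<le> t" "t \<le> l n" for n s t
    using g(1)[of n] that by (simp add: geodesic_def l_def)
  have xy: "\<delta> (x n) (y n) = l n" for n using gd[of 0 n "l n"] l0 g(2,3) by (simp add: l_def)
  define r where "r = D p p'"
  have lim: "((\<lambda>n. l n / d n) \<longlongrightarrow> r) \<omega>"
    using cone_point_dist[OF x(1) y(1)] by (simp add: xy r_def x y)
  have r0: "0 \<le> r" by (simp add: r_def)
  \<comment> \<open>The time is capped at \<open>l n\<close>, because \<open>r * d n\<close> may
    exceed the length of \<open>g n\<close>; the excess is negligible relative to
    \<open>d n\<close>.\<close>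
  define A where "A t n = snd (g n) (min (t * d n) (l n))" for t n
  have md: "0 \<le> min (t * d n) (l n)" if "0 \<le> t" for t n
    using l0 scale[of n] that by (auto simp: less_imp_le)
  have scaled: "\<bar>u - v\<bar> / d n = \<bar>u / d n - v / d n\<bar>" for u v n
    using scale[of n] by (simp add: diff_divide_distrib[symmetric] abs_divide)
  have min_scaled: "min (t * d n) (l n) / d n = min t (l n / d n)" for t n
    using scale[of n] by (auto simp: min_def field_simps)
  have qA: "q (A s) (A t) n = \<bar>min s (l n / d n) - min t (l n / d n)\<bar>" if "0 \<le> s" "0 \<le> t" for s t n
    using gd[of "min (s * d n) (l n)" n "min (t * d n) (l n)"] md that
    by (simp add: A_def scaled min_scaled)
  have A0: "A 0 = x" using l0 by (auto simp: A_def g(2) fun_eq_iff)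
  have AS: "A t \<in> S" if "0 \<le> t" for t
  proof (rule cone_seqs_near[OF x(1)])
    show "A t n \<in> X" for n using gX md[OF that] by (simp add: A_def)
    show "eventually (\<lambda>n. q x (A t) n \<le> t) \<omega>"
      using qA[of 0 t] that l0 scale by (intro always_eventually) (auto simp: A0 min_def less_imp_le)
  qed
  have dA: "D (P (A s)) (P (A t)) = \<bar>s - t\<bar>" if "0 \<le> s" "s \<le> r" "0 \<le> t" "t \<le> r" for s t
  proof (rule cone_point_dist_eq[OF AS AS])
    have "((\<lambda>n. \<bar>min s (l n / d n) - min t (l n / d n)\<bar>) \<longlongrightarrow> \<bar>min s r - min t r\<bar>) \<omega>"
      by (intro tendsto_intros lim)
    then show "(q (A s) (A t) \<longlongrightarrow> \<bar>s - t\<bar>) \<omega>" using that qA by (simp add: min_absorb1)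
  qed (use that in auto)
  have iso: "C.isom (\<lambda>t. P (A t)) 0 r" unfolding C.isom_def using dA cone_point_in AS by auto
  \<comment> \<open>A sequence on the \<open>g n\<close> is determined in the cone by the limit of
    its rescaled times. This yields both that the path fills the limit set and that it ends at
    \<open>p'\<close>.\<close>
  have near: "P a = P (A t)" if a: "a \<in> S" "\<And>n. 0 \<le> \<tau> n \<and> \<tau> n \<le> l n"
    "eventually (\<lambda>n. a n = snd (g n) (\<tau> n)) \<omega>" and t: "((\<lambda>n. \<tau> n / d n) \<longlongrightarrow> t) \<omega>" "0 \<le> t" "t \<le> r" for a \<tau> t
  proof (rule cone_point_eq[OF a(1) AS])
    have "((\<lambda>n. \<bar>\<tau> n / d n - min t (l n / d n)\<bar>) \<longlongrightarrow> \<bar>t - min t r\<bar>) \<omega>"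
      by (intro tendsto_intros lim t)
    moreover have "eventually (\<lambda>n. \<bar>\<tau> n / d n - min t (l n / d n)\<bar> = q a (A t) n) \<omega>"
      using a(3)
    proof eventually_elim
      case (elim n)
      then show ?case
        using gd[of "\<tau> n" n "min (t * d n) (l n)"] md[OF t(2), of n] a(2)[of n]
        by (simp add: A_def scaled min_scaled)
    qed
    ultimately show "(q a (A t) \<longlongrightarrow> 0) \<omega>" using t by (simp add: Lim_transform_eventually min_absorb1)
  qed (rule t)
  have image: "(\<lambda>t. P (A t)) ` {0..r} = limit_set X \<delta> \<omega> e d (\<lambda>n. arc_image (g n))"
  proof (intro equalityI subsetI)
    fix w assume "w \<in> (\<lambda>t. P (A t)) ` {0..r}"
    then obtain t where t: "0 \<le> t" "t \<le> r" "w = P (A t)" by auto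
    have "A t n \<in> arc_image (g n)" for n using md[OF t(1), of n] by (auto simp: A_def arc_image_def l_def)
    then show "w \<in> limit_set X \<delta> \<omega> e d (\<lambda>n. arc_image (g n))"
      using AS t unfolding limit_set_def by auto
  next
    fix w assume "w \<in> limit_set X \<delta> \<omega> e d (\<lambda>n. arc_image (g n))"
    then obtain a where a: "w = P a" "a \<in> S" "eventually (\<lambda>n. a n \<in> arc_image (g n)) \<omega>"
      unfolding limit_set_def by auto
    \<comment> \<open>Since \<open>a n\<close> lies on \<open>g n\<close> only almost surely, the
      bounds on the time are kept for every \<open>n\<close> and only the equation is
      conditional.\<close>
    have "\<exists>\<tau>. 0 \<le> \<tau> \<and> \<tau> \<le> l n \<and> (a n \<in> arc_image (g n) \<longrightarrow> a n = snd (g n) \<tau>)" for n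
      using l0[of n] by (cases "a n \<in> arc_image (g n)") (auto simp: arc_image_def l_def)
    then obtain \<tau> where \<tau>: "\<And>n. 0 \<le> \<tau> n \<and> \<tau> n \<le> l n"
      "\<And>n. a n \<in> arc_image (g n) \<Longrightarrow> a n = snd (g n) (\<tau> n)" by metis
    have ev: "eventually (\<lambda>n. a n = snd (g n) (\<tau> n)) \<omega>" using a(3) \<tau>(2) by (auto elim: eventually_mono)
    define t where "t = D (P x) (P a)"
    have "eventually (\<lambda>n. q x a n = \<tau> n / d n) \<omega>"
      using ev
    proof eventually_elim
      case (elim n)
      then show ?case using gd[of 0 n "\<tau> n"] \<tau>(1)[of n] l0[of n] g(2)[of n] by simp
    qed
    then have lt: "((\<lambda>n. \<tau> n / d n) \<longlongrightarrow> t) \<omega>"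
      using cone_point_dist[OF x(1) a(2)] unfolding t_def by (rule Lim_transform_eventually[rotated])
    have "t \<le> r"
      using \<tau>(1) scale
      by (intro tendsto_le[OF nonbot lim lt] always_eventually allI divide_right_mono) (auto simp: less_imp_le)
    moreover have "0 \<le> t" by (simp add: t_def)
    ultimately show "w \<in> (\<lambda>t. P (A t)) ` {0..r}" using near[OF a(2) \<tau>(1) ev lt] a(1) by auto
  qed
  have "P (A 0) = p" "P (A r) = p'"
    using near[OF y(1), of l r] l0 g(3) lim r0 by (auto simp: A0 x y l_def)
  then have "C.seg p p' ((\<lambda>t. P (A t)) ` {0..r})" using C.seg_image[OF iso r0] by simp
  moreover have "limit_segment ((\<lambda>t. P (A t)) ` {0..r})" unfolding limit_segment_def using g(1) image by auto
  ultimately show ?thesis by blast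
qed

text \<open>Each \<open>g n\<close> is cut at points representing \<open>f s\<close> and
  \<open>f t\<close>. On both sides, lying between the cuts means equality in the triangle
  inequality, and this passes from \<open>X\<close> to the cone and, approximately, back.\<close>

lemma limit_segment_restrict:
  assumes f: "C.isom f a b" and K: "limit_segment (f ` {a..b})" and st: "a \<le> s" "s \<le> t" "t \<le> b"
  shows "limit_segment (f ` {s..t})"
proof -
  obtain g where g: "\<And>n. geodesic X \<delta> (g n)" and im: "f ` {a..b} = limit_set X \<delta> \<omega> e d (\<lambda>n. arc_image (g n))"
    using K unfolding limit_segment_def by blast
  define l where "l n = fst (g n)" for n
  have l0: "0 \<le> l n" for n using g by (simp add: geodesic_def l_def)
  have gX: "snd (g n) t \<in> X" if "0 \<le> t" "t \<le> l n" for n t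
    using g[of n] that by (simp add: geodesic_def l_def)
  have gd: "\<delta> (snd (g n) s) (snd (g n) t) = \<bar>s - t\<bar>" if "0 \<le> s" "s \<le> l n" "0 \<le> t" "t \<le> l n" for n s t
    using g[of n] that by (simp add: geodesic_def l_def)
  have rep: "\<exists>c \<tau>. f w = P c \<and> c \<in> S \<and> (\<forall>n. 0 \<le> \<tau> n \<and> \<tau> n \<le> l n) \<and>
      eventually (\<lambda>n. c n = snd (g n) (\<tau> n)) \<omega>" if "a \<le> w" "w \<le> b" for w
  proof -
    have "f w \<in> limit_set X \<delta> \<omega> e d (\<lambda>n. arc_image (g n))" using im that by auto
    then obtain c where c: "f w = P c" "c \<in> S" "eventually (\<lambda>n. c n \<in> arc_image (g n)) \<omega>"
      unfolding limit_set_def by auto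
    have "\<exists>\<tau>. 0 \<le> \<tau> \<and> \<tau> \<le> l n \<and> (c n \<in> arc_image (g n) \<longrightarrow> c n = snd (g n) \<tau>)" for n
      using l0[of n] by (cases "c n \<in> arc_image (g n)") (auto simp: arc_image_def l_def)
    then obtain \<tau> where \<tau>: "\<And>n. 0 \<le> \<tau> n \<and> \<tau> n \<le> l n"
      "\<And>n. c n \<in> arc_image (g n) \<Longrightarrow> c n = snd (g n) (\<tau> n)" by metis
    then show ?thesis using c by (intro exI[of _ c] exI[of _ \<tau>]) (auto elim: eventually_mono)
  qed
  obtain u \<sigma> where u: "f s = P u" "u \<in> S" "\<And>n. 0 \<le> \<sigma> n \<and> \<sigma> n \<le> l n" "eventually (\<lambda>n. u n = snd (g n) (\<sigma> n)) \<omega>"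
    using rep[of s] st by auto
  obtain v \<tau> where v: "f t = P v" "v \<in> S" "\<And>n. 0 \<le> \<tau> n \<and> \<tau> n \<le> l n" "eventually (\<lambda>n. v n = snd (g n) (\<tau> n)) \<omega>"
    using rep[of t] st by auto
  \<comment> \<open>Equality of images does not fix the direction in which \<open>g n\<close> is
    traversed relative to \<open>f\<close>, so the two times are put in order.\<close>
  define lo hi where "lo n = min (\<sigma> n) (\<tau> n)" and "hi n = max (\<sigma> n) (\<tau> n)" for n
  have lohi: "0 \<le> lo n" "lo n \<le> hi n" "hi n \<le> l n" for n using u(3) v(3) by (auto simp: lo_def hi_def)
  define g' where "g' n = (hi n - lo n, \<lambda>x. snd (g n) (x + lo n))" for n
  have g': "geodesic X \<delta> (g' n)" for n
  proof -
    have "snd (g n) (x + lo n) \<in> X" if "0 \<le> x" "x \<le> hi n - lo n" for x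
      using gX[of "x + lo n" n] lohi[of n] that by auto
    moreover have "\<delta> (snd (g n) (x + lo n)) (snd (g n) (x' + lo n)) = \<bar>x - x'\<bar>"
      if "0 \<le> x" "x \<le> hi n - lo n" "0 \<le> x'" "x' \<le> hi n - lo n" for x x'
      using gd[of "x + lo n" n "x' + lo n"] lohi[of n] that by auto
    ultimately show ?thesis using lohi[of n] by (auto simp: g'_def geodesic_def)
  qed
  have g'im: "arc_image (g' n) = snd (g n) ` {lo n..hi n}" for n
  proof -
    have "(\<lambda>x. x + lo n) ` {0..hi n - lo n} = {lo n..hi n}" by (auto intro!: image_eqI[of _ _ "_ - lo n"])
    then show ?thesis
      using image_comp[of "snd (g n)" "\<lambda>x. x + lo n" "{0..hi n - lo n}"]
      by (simp add: arc_image_def g'_def comp_def)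
  qed
  have "f ` {s..t} = limit_set X \<delta> \<omega> e d (\<lambda>n. arc_image (g' n))"
  proof (intro equalityI subsetI)
    fix p assume "p \<in> f ` {s..t}"
    then obtain w where w: "p = f w" "s \<le> w" "w \<le> t" by auto
    obtain c \<rho> where c: "f w = P c" "c \<in> S" "\<And>n. 0 \<le> \<rho> n \<and> \<rho> n \<le> l n" "eventually (\<lambda>n. c n = snd (g n) (\<rho> n)) \<omega>"
      using rep[of w] w st by auto
    \<comment> \<open>The distance from \<open>\<rho> n\<close> to \<open>[lo n, hi n]\<close> is half the defect of the triangle inequality,
      which vanishes in the limit.\<close>
    define \<rho>' where "\<rho>' n = max (lo n) (min (\<rho> n) (hi n))" for n
    have \<rho>': "lo n \<le> \<rho>' n" "\<rho>' n \<le> hi n" for n using lohi[of n] by (auto simp: \<rho>'_def)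
    define c' where "c' n = snd (g n) (\<rho>' n)" for n
    have ev: "eventually (\<lambda>n. (q u c n + q c v n - q u v n) / 2 = q c c' n) \<omega>"
      using c(4) u(4) v(4)
    proof eventually_elim
      case (elim n)
      have "\<delta> (u n) (c n) = \<bar>\<sigma> n - \<rho> n\<bar>" "\<delta> (c n) (v n) = \<bar>\<rho> n - \<tau> n\<bar>" "\<delta> (u n) (v n) = \<bar>\<sigma> n - \<tau> n\<bar>"
        "\<delta> (c n) (c' n) = \<bar>\<rho> n - \<rho>' n\<bar>"
        using elim gd c(3)[of n] u(3)[of n] v(3)[of n] lohi[of n] \<rho>'[of n] by (auto simp: c'_def)
      moreover have "(\<bar>\<sigma> n - \<rho> n\<bar> + \<bar>\<rho> n - \<tau> n\<bar> - \<bar>\<sigma> n - \<tau> n\<bar>) / 2 = \<bar>\<rho> n - \<rho>' n\<bar>"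
        by (auto simp: \<rho>'_def lo_def hi_def min_def max_def)
      ultimately show ?case
        by (metis (no_types, opaque_lifting) add_divide_distrib diff_divide_distrib divide_divide_eq_left mult.commute)
    qed
    have "D (f s) (f w) = w - s" "D (f w) (f t) = t - w" "D (f s) (f t) = t - s"
      using C.isom_dist[OF f] w st by auto
    then have "((\<lambda>n. (q u c n + q c v n - q u v n) / 2) \<longlongrightarrow> ((w - s) + (t - w) - (t - s)) / 2) \<omega>"
      using cone_point_dist[OF u(2) c(2)] cone_point_dist[OF c(2) v(2)] cone_point_dist[OF u(2) v(2)] u(1) v(1) c(1)
      by (intro tendsto_intros) auto
    then have lim: "(q c c' \<longlongrightarrow> 0) \<omega>" using Lim_transform_eventually[OF _ ev] by simp
    have c'S: "c' \<in> S"
    proof (rule cone_seqs_near[OF c(2)])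
      show "c' n \<in> X" for n using gX \<rho>'[of n] lohi[of n] by (auto simp: c'_def)
      show "eventually (\<lambda>n. q c c' n \<le> 1) \<omega>"
        using order_tendstoD(2)[OF lim, of 1] by (auto elim: eventually_mono)
    qed
    have "p = P c'" using cone_point_eq[OF c(2) c'S lim] w c by simp
    moreover have "c' n \<in> arc_image (g' n)" for n using \<rho>'[of n] by (auto simp: g'im c'_def)
    ultimately show "p \<in> limit_set X \<delta> \<omega> e d (\<lambda>n. arc_image (g' n))"
      using c'S unfolding limit_set_def by auto
  next
    fix p assume "p \<in> limit_set X \<delta> \<omega> e d (\<lambda>n. arc_image (g' n))"
    then obtain c where c: "p = P c" "c \<in> S" "eventually (\<lambda>n. c n \<in> arc_image (g' n)) \<omega>"
      unfolding limit_set_def by auto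
    have "snd (g n) ` {lo n..hi n} \<subseteq> snd (g n) ` {0..l n}" for n
      using lohi[of n] by (intro image_mono) auto
    then have "arc_image (g' n) \<subseteq> arc_image (g n)" for n
      unfolding g'im by (simp add: arc_image_def l_def)
    then have "eventually (\<lambda>n. c n \<in> arc_image (g n)) \<omega>"
      by (intro eventually_mono[OF c(3)]) blast
    then have "p \<in> f ` {a..b}"
      unfolding im limit_set_def using c by blast
    then obtain w where w: "p = f w" "a \<le> w" "w \<le> b" by auto
    \<comment> \<open>Between the cuts distances add up exactly; in the limit \<open>f w\<close>
      lies between \<open>f s\<close> and \<open>f t\<close>, which forces \<open>w\<close> into
      \<open>{s..t}\<close>.\<close>
    have ev: "eventually (\<lambda>n. q u c n + q c v n = q u v n) \<omega>"
      using c(3) u(4) v(4)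
    proof eventually_elim
      case (elim n)
      obtain \<rho> where \<rho>: "c n = snd (g n) \<rho>" "lo n \<le> \<rho>" "\<rho> \<le> hi n" using elim(1) g'im by auto
      have "\<delta> (u n) (c n) = \<bar>\<sigma> n - \<rho>\<bar>" "\<delta> (c n) (v n) = \<bar>\<rho> - \<tau> n\<bar>" "\<delta> (u n) (v n) = \<bar>\<sigma> n - \<tau> n\<bar>"
        using elim gd \<rho> u(3)[of n] v(3)[of n] lohi[of n] by auto
      moreover have "\<bar>\<sigma> n - \<rho>\<bar> + \<bar>\<rho> - \<tau> n\<bar> = \<bar>\<sigma> n - \<tau> n\<bar>"
        using \<rho> by (auto simp: lo_def hi_def min_def max_def split: if_splits)
      ultimately show ?case by (metis add_divide_distrib)
    qed
    have "((\<lambda>n. q u c n + q c v n) \<longlongrightarrow> D (P u) (P c) + D (P c) (P v)) \<omega>"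
      using cone_point_dist[OF u(2) c(2)] cone_point_dist[OF c(2) v(2)] by (intro tendsto_add)
    then have "(q u v \<longlongrightarrow> D (P u) (P c) + D (P c) (P v)) \<omega>" using ev by (rule Lim_transform_eventually)
    then have "D (f s) (f t) = D (f s) (f w) + D (f w) (f t)"
      using cone_point_dist_eq[OF u(2) v(2)] u(1) v(1) c(1) w(1) by simp
    moreover have "D (f s) (f t) = \<bar>s - t\<bar>" "D (f s) (f w) = \<bar>s - w\<bar>" "D (f w) (f t) = \<bar>w - t\<bar>"
      using w st by (simp_all add: C.isom_dist[OF f])
    ultimately have "\<bar>s - t\<bar> = \<bar>s - w\<bar> + \<bar>w - t\<bar>" by metis
    then have "s \<le> w" "w \<le> t" using st(2) by linarith+
    then have "w \<in> {s..t}" by simp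
    then show "p \<in> f ` {s..t}" using w by auto
  qed
  then show ?thesis unfolding limit_segment_def using g' by blast
qed

end

section \<open>Transfer of the metric argument to the asymptotic cone\<close>

theorem corollary4p18:
  fixes X :: "'a set" and \<delta> :: "'a \<Rightarrow> 'a \<Rightarrow> real"
    and \<omega> :: "nat filter" and e :: "nat \<Rightarrow> 'a" and d :: "nat \<Rightarrow> real"
    and \<A> :: "(nat \<Rightarrow> 'a) set set set"
  assumes geodesic_X: "geodesic_metric_space X \<delta>"
    and ultra: "nonprincipal_ultrafilter \<omega>"
    and base: "\<And>n. e n \<in> X"
    and scale_pos: "\<And>n. 0 < d n"
    and scale_lim: "filterlim d at_top \<omega>"
    and closed: "\<And>A. A \<in> \<A> \<Longrightarrow> closedin (cone_topology X \<delta> \<omega> e d) A"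
    and T1: "\<And>A B. A \<in> \<A> \<Longrightarrow> B \<in> \<A> \<Longrightarrow> A \<noteq> B \<Longrightarrow> \<exists>p. A \<inter> B \<subseteq> {p}"
    and Pi3: "\<And>\<alpha> \<beta> \<gamma>.
        geodesic_triangle (asymp_cone X \<delta> \<omega> e d) (cone_dist X \<delta> \<omega> e d) \<alpha> \<beta> \<gamma> \<Longrightarrow>
        simple_triangle \<alpha> \<beta> \<gamma> \<Longrightarrow> nontrivial_triangle \<alpha> \<beta> \<gamma> \<Longrightarrow>
        limit_geodesic X \<delta> \<omega> e d \<alpha> \<Longrightarrow> limit_geodesic X \<delta> \<omega> e d \<beta> \<Longrightarrow>
        limit_geodesic X \<delta> \<omega> e d \<gamma> \<Longrightarrow> \<exists>A\<in>\<A>. triangle_set \<alpha> \<beta> \<gamma> \<subseteq> A"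
  shows "\<forall>\<alpha> \<beta> \<gamma>.
        geodesic_triangle (asymp_cone X \<delta> \<omega> e d) (cone_dist X \<delta> \<omega> e d) \<alpha> \<beta> \<gamma> \<and>
        simple_triangle \<alpha> \<beta> \<gamma> \<and> nontrivial_triangle \<alpha> \<beta> \<gamma>
        \<longrightarrow> (\<exists>A\<in>\<A>. triangle_set \<alpha> \<beta> \<gamma> \<subseteq> A)"
proof (intro allI impI, elim conjE)
  fix \<alpha> \<beta> \<gamma>
  assume T: "geodesic_triangle (asymp_cone X \<delta> \<omega> e d) (cone_dist X \<delta> \<omega> e d) \<alpha> \<beta> \<gamma>"
    "simple_triangle \<alpha> \<beta> \<gamma>" "nontrivial_triangle \<alpha> \<beta> \<gamma>"
  interpret Y: cone_data X \<delta> \<omega> e d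
  proof (intro cone_data.intro cone_data_axioms.intro)
    show "Metric_space X \<delta>" using geodesic_X by (simp add: geodesic_metric_space_def)
    show "ultrafilter \<omega>" using ultra by (simp add: nonprincipal_ultrafilter_def)
  qed (use base scale_pos in auto)
  interpret limit_pieces Y.Con Y.D Y.limit_segment \<A>
  proof
    fix x y assume "x \<in> Y.Con" "y \<in> Y.Con"
    then show "\<exists>K. Y.C.seg x y K \<and> Y.limit_segment K" by (rule Y.limit_segment_exists[OF geodesic_X])
  next
    fix f a b s t
    assume "Y.C.isom f a b" "Y.limit_segment (f ` {a..b})" "a \<le> s" "s \<le> t" "t \<le> b"
    then show "Y.limit_segment (f ` {s..t})" by (rule Y.limit_segment_restrict)
  next
    fix A assume "A \<in> \<A>"
    then show "closedin Y.C.mtopology A" using closed by (simp add: cone_topology_def)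
  next
    fix A B assume "A \<in> \<A>" "B \<in> \<A>" "A \<noteq> B"
    then show "\<exists>p. A \<inter> B \<subseteq> {p}" by (rule T1)
  next
    fix x y z F G H
    assume T': "Y.C.tri x y z F G H" and L: "Y.limit_segment F" "Y.limit_segment G" "Y.limit_segment H"
    obtain \<alpha> \<beta> \<gamma> where *: "geodesic_triangle Y.Con Y.D \<alpha> \<beta> \<gamma>" "simple_triangle \<alpha> \<beta> \<gamma>"
      "nontrivial_triangle \<alpha> \<beta> \<gamma>" and im: "arc_image \<alpha> = F" "arc_image \<beta> = G" "arc_image \<gamma> = H"
      using Y.C.tri_arcs[OF T'] by blast
    have "limit_geodesic X \<delta> \<omega> e d \<alpha>" "limit_geodesic X \<delta> \<omega> e d \<beta>" "limit_geodesic X \<delta> \<omega> e d \<gamma>"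
      using *(1) L im unfolding limit_geodesic_def Y.limit_segment_def geodesic_triangle_def by simp_all
    then show "\<exists>A\<in>\<A>. F \<union> G \<union> H \<subseteq> A"
      using Pi3[OF *] im by (simp add: triangle_set_def)
  qed
  show "\<exists>A\<in>\<A>. triangle_set \<alpha> \<beta> \<gamma> \<subseteq> A" using T by (rule geodesic_triangle_piece)
qed

end
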